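(* Let $a,b$ be non-negative integers and let $p$ be a prime with $p>2a+2b+1$. Then $$S_{p-1}(\{2\}^a,1,\{2\}^b) \equiv \frac{4(b-a)(1-4^{-a-b})}{(2a+1)(2b+1)}\binom{2a+2b}{2a}B_{p-2a-2b-1} \pmod{p},$$ $$H_{p-1}(\{2\}^a,1,\{2\}^b) \equiv \frac{4(-1)^{a+b}(a-b)(1-4^{-a-b})}{(2a+1)(2b+1)}\binom{2a+2b}{2a}B_{p-2a-2b-1}\pmod{p}.$$
   Context: For a sequence $(s_1,\dots,s_r)$ of positive integers and an integer $n\ge 0$: $H_n(s_1,\dots,s_r)=\sum_{1\le k_1<\cdots<k_r\le n}\frac{1}{k_1^{s_1}\cdots k_r^{s_r}}$ and $S_n(s_1,\dots,s_r)=\sum_{1\le k_1\le\cdots\le k_r\le n}\frac{1}{k_1^{s_1}\cdots k_r^{s_r}}$, with $H_n(s_1,\dots,s_r)=0$ if $n<r$. $\{2\}^a$ denotes $2$ repeated $a$ times. $B_k$ are the Bernoulli numbers defined by $\frac{x}{e^x-1}=\sum_{k\ge0}B_k\frac{x^k}{k!}$. For rational numbers $x,y$, $x\equiv y\pmod{p}$ means that $x-y$ has $p$-adic valuation at least $1$.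
   Formalization: The prime p is assumed to be different from 2; for p = 2 the condition forces a = b = 0, where both sums S_1(1) = H_1(1) equal 1 while both right-hand sides are 0, so the congruences fail. *)

theory Defs
  imports "HOL-Computational_Algebra.Computational_Algebra"
begin

definition multiple_harmonic_sum :: "nat list \<Rightarrow> nat \<Rightarrow> rat" where
  "multiple_harmonic_sum s n =
     (\<Sum>k\<in>{k. length k = length s \<and> set k \<subseteq> {1..n} \<and> sorted_wrt (<) k}.
        1 / (\<Prod>i<length s. of_nat (k ! i) ^ (s ! i)))"

definition multiple_harmonic_star_sum :: "nat list \<Rightarrow> nat \<Rightarrow> rat" where
  "multiple_harmonic_star_sum s n =
     (\<Sum>k\<in>{k. length k = length s \<and> set k \<subseteq> {1..n} \<and> sorted_wrt (\<le>) k}.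
        1 / (\<Prod>i<length s. of_nat (k ! i) ^ (s ! i)))"

text \<open>
  The exponential generating function is \<open>x / (e\<^sup>x - 1)\<close>, so \<open>bernoulli 1 = - 1 / 2\<close>.
  Division of formal power series cancels the common factor \<open>x\<close> of numerator and
  denominator; \<open>bernoulli_egf\<close> below confirms that it yields the intended series.
\<close>
definition bernoulli :: "nat \<Rightarrow> rat" where
  "bernoulli k = fact k * fps_nth (fps_X / (fps_exp 1 - 1)) k"

lemma bernoulli_egf:
  "Abs_fps (\<lambda>k. bernoulli k / fact k) * (fps_exp 1 - 1) = fps_X"
proof -
  have "Abs_fps (\<lambda>k. bernoulli k / fact k) = fps_X / (fps_exp 1 - 1)"
    by (simp add: fps_eq_iff bernoulli_def)
  moreover have "subdegree (fps_exp 1 - 1 :: rat fps) = 1"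
    by (rule subdegreeI) auto
  then have "(fps_exp 1 - 1 :: rat fps) dvd fps_X"
    by (subst fps_dvd_iff) auto
  ultimately show ?thesis
    by simp
qed

text \<open>Only meaningful for \<open>x \<noteq> 0\<close>; the case of infinite valuation is treated in \<open>rat_cong\<close>.\<close>
definition padic_valuation :: "nat \<Rightarrow> rat \<Rightarrow> int" where
  "padic_valuation p x =
     (case quotient_of x of (c, d) \<Rightarrow>
        int (multiplicity (int p) c) - int (multiplicity (int p) d))"

text \<open>The disjunct \<open>x = y\<close> accounts for the infinite valuation of \<open>0\<close>.\<close>
definition rat_cong :: "rat \<Rightarrow> rat \<Rightarrow> nat \<Rightarrow> bool" where
  "rat_cong x y p \<longleftrightarrow> x = y \<or> padic_valuation p (x - y) \<ge> 1"

end

theory Submission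
  imports Defs
begin

text \<open>
  Put n = (p - 1) / 2 and E_k(t) = (1 - t/1^2) (1 - t/2^2) ... (1 - t/k^2), and write [f]_i for the
  coefficient of t^i in f.  Splitting a summation tuple at the entry with exponent 1 gives
  H({2}^a,1,{2}^b) = (-1)^(a+b) (sum over k < p of (1/k) [E_(k-1)]_a [E_(p-1)/E_k]_b) and
  S({2}^a,1,{2}^b) = sum over k < p of (1/k) [1/E_k]_a [E_(k-1)/E_(p-1)]_b.
  
  Modulo p, E_(p-1) is 1 up to terms of degree at least n, because each of its two halves is a
  polynomial of degree n that vanishes at all n nonzero squares.  Hence E_(p-1) may be replaced by 1
  in both formulas, and both sums come down to M(a,b) = sum over k < p of (1/k) [E_(k-1)]_a [1/E_k]_b, namely
  H = (-1)^(a+b) M(a,b) and S = M(b,a).  The reflection k \<mapsto> p - k exchanges the roles of the two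
  coefficients and changes the sign, so M(a,b) = G(a,b) - G(b,a), where G is the same sum over k \<le> n.
  
  The point of passing to k \<le> n is that the partial fraction decomposition of 1/E_k over its poles j^2
  has denominators (k-j)! (k+j)! with k + j \<le> p - 1, which are prime to p.  It expresses G(a,b) through
  the coefficients of t^a in polynomials W_j of degree less than n, and the values of W_j at m^2 are
  explicit: they are 0, a half or the whole of -(-1)^m/m according to whether m < j, m = j or m > j.
  A polynomial q of degree less than n is recovered modulo p from its values at squares by
  [q]_a = -2 (sum over m \<le> n of q(m^2) m^(-2a)), by orthogonality of power sums.  This gives
  G(a,b) = -4 (sum over j \<le> m \<le> n of (-1)^(j+m) j^(-2b) m^(-2a-1)), terms with j = m counted half.
  
  By Fermat, j^(-2b) = j^(2n-2b).  The sum over j is now an alternating power sum, an odd polynomial in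
  m with coefficients from the expansion of tanh(t/2); being free of signs, it can be summed over m by
  the same recovery formula, which picks out its coefficient of m^(2a+1).  The result is a binomial
  coefficient times a Taylor coefficient of tanh(t/2), that is, times (2^r - 1) B_r / r with
  r = p - 1 - 2a - 2b.  Reducing modulo p and antisymmetrising in a and b yields both formulas.
\<close>

section \<open>Congruence of rational numbers modulo a prime\<close>

locale odd_prime =
  fixes p :: nat
  assumes prime: "prime p" and not_two: "p \<noteq> 2"
begin

definition half :: nat where "half = (p - 1) div 2"

lemma p_eq: "p = 2 * half + 1"
  using prime_odd_nat[OF prime] prime_gt_1_nat[OF prime] not_two prime_ge_2_nat[OF prime]
  unfolding half_def by (simp add: odd_two_times_div_two_nat)

lemma half_pos: "half > 0"
  using p_eq prime_gt_1_nat[OF prime] by auto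

lemma p_pos: "p > 0"
  using p_eq by simp

text \<open>
  The localisation of the integers at p inside the rationals.  Working in it instead of the field with p
  elements lets exact identities with denominators be used as they are, and reduced afterwards.
\<close>
definition integral :: "rat \<Rightarrow> bool" where
  "integral x \<longleftrightarrow> (\<exists>u v :: int. \<not> int p dvd v \<and> x = of_int u / of_int v)"

definition cong_p :: "rat \<Rightarrow> rat \<Rightarrow> bool" (infix "\<approx>" 50) where
  "x \<approx> y \<longleftrightarrow> (\<exists>z. integral z \<and> x - y = of_nat p * z)"

lemma prime_int: "prime (int p)" using prime by simp

lemma integralE:
  assumes "integral x"
  obtains u v :: int where "\<not> int p dvd v" "v \<noteq> 0" "x = of_int u / of_int v"
  using assms unfolding integral_def by (metis dvd_0_right)

lemma integral_of_int [simp]: "integral (of_int k)"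
  unfolding integral_def
  by (rule exI[of _ k], rule exI[of _ 1]) (use prime_int in \<open>auto simp: zdvd_not_zless prime_gt_1_int\<close>)

lemma integral_of_nat [simp]: "integral (of_nat k)"
  using integral_of_int[of "int k"] by simp

lemma integral_numeral [simp]: "integral (numeral k)"
  using integral_of_int[of "numeral k"] by simp

lemma integral_0 [simp]: "integral 0" and integral_1 [simp]: "integral 1"
  using integral_of_int[of 0] integral_of_int[of 1] by simp_all

lemma integral_mult [simp, intro]: "integral (x * y)" if x: "integral x" and y: "integral y"
proof -
  obtain u v where 1: "\<not> int p dvd v" "x = of_int u / of_int v" using x by (elim integralE)
  obtain u' v' where 2: "\<not> int p dvd v'" "y = of_int u' / of_int v'" using y by (elim integralE)
  show ?thesis unfolding integral_def
    by (rule exI[of _ "u * u'"], rule exI[of _ "v * v'"])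
       (use 1 2 prime_int in \<open>auto simp: prime_dvd_mult_iff\<close>)
qed

lemma integral_add [simp, intro]: "integral (x + y)" if x: "integral x" and y: "integral y"
proof -
  obtain u v where 1: "\<not> int p dvd v" "v \<noteq> 0" "x = of_int u / of_int v" using x by (elim integralE)
  obtain u' v' where 2: "\<not> int p dvd v'" "v' \<noteq> 0" "y = of_int u' / of_int v'" using y by (elim integralE)
  show ?thesis unfolding integral_def
    by (rule exI[of _ "u * v' + u' * v"], rule exI[of _ "v * v'"])
       (use 1 2 prime_int in \<open>auto simp: prime_dvd_mult_iff field_simps\<close>)
qed

lemma integral_uminus [simp, intro]: "integral (- x)" if "integral x"
  using integral_mult[OF integral_of_int[of "-1"] that] by simp

lemma integral_diff [simp, intro]: "integral (x - y)" if "integral x" "integral y"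
  using integral_add[OF that(1) integral_uminus[OF that(2)]] by simp

lemma integral_power [simp, intro]: "integral (x ^ k)" if "integral x"
  by (induction k) (use that in auto)

lemma integral_sum [simp, intro]: "integral (\<Sum>i\<in>A. f i)" if "\<And>i. i \<in> A \<Longrightarrow> integral (f i)"
  using that by (induction A rule: infinite_finite_induct) auto

lemma integral_prod: "integral (\<Prod>i\<in>A. f i)" if "\<And>i. i \<in> A \<Longrightarrow> integral (f i)"
  using that by (induction A rule: infinite_finite_induct) auto

lemma integral_inverse_of_nat [simp, intro]: "integral (1 / of_nat k)" if "\<not> p dvd k"
  unfolding integral_def
  by (rule exI[of _ 1], rule exI[of _ "int k"]) (use that in simp)

lemma integral_divide_of_nat [simp, intro]: "integral (x / of_nat k)" if "integral x" "\<not> p dvd k"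
  using integral_mult[OF that(1) integral_inverse_of_nat[OF that(2)]] by simp

lemma cong_p_refl [simp]: "x \<approx> x"
  unfolding cong_p_def by (auto intro: exI[of _ 0])

lemma cong_p_sym: "y \<approx> x" if xy: "x \<approx> y"
proof -
  obtain z where "integral z" "x - y = of_nat p * z" using xy unfolding cong_p_def by auto
  then show ?thesis unfolding cong_p_def
    by (intro exI[of _ "- z"]) (auto simp: algebra_simps)
qed

lemma cong_p_add: "x + y \<approx> x' + y'" if xx: "x \<approx> x'" and yy: "y \<approx> y'"
proof -
  obtain z where "integral z" "x - x' = of_nat p * z" using xx unfolding cong_p_def by auto
  moreover obtain w where "integral w" "y - y' = of_nat p * w" using yy unfolding cong_p_def by auto
  ultimately show ?thesis unfolding cong_p_def
    by (intro exI[of _ "z + w"]) (auto simp: algebra_simps)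
qed

lemma cong_p_trans [trans]: "x \<approx> z" if "x \<approx> y" "y \<approx> z"
  using cong_p_add[OF that] unfolding cong_p_def by (simp add: algebra_simps)

lemma cong_p_mult_left: "c * x \<approx> c * y" if xy: "x \<approx> y" and c: "integral c"
proof -
  obtain z where "integral z" "x - y = of_nat p * z" using xy unfolding cong_p_def by auto
  then show ?thesis unfolding cong_p_def
    by (intro exI[of _ "c * z"]) (use c in \<open>auto simp: algebra_simps simp flip: right_diff_distrib\<close>)
qed

lemma cong_p_mult:
  assumes "x \<approx> x'" "y \<approx> y'" "integral x'" "integral y"
  shows "x * y \<approx> x' * y'"
  using cong_p_trans[of "x * y" "x' * y" "x' * y'"]
    cong_p_mult_left[OF assms(1,4)] cong_p_mult_left[OF assms(2,3)] by (simp add: mult.commute)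

lemma cong_p_uminus: "- x \<approx> - y" if "x \<approx> y"
  using cong_p_mult_left[OF that integral_of_int[of "-1"]] by simp

lemma cong_p_diff: "x - y \<approx> x' - y'" if "x \<approx> x'" "y \<approx> y'"
  using cong_p_add[OF that(1) cong_p_uminus[OF that(2)]] by simp

lemma cong_p_sum: "(\<Sum>i\<in>A. f i) \<approx> (\<Sum>i\<in>A. g i)" if "\<And>i. i \<in> A \<Longrightarrow> f i \<approx> g i"
  using that by (induction A rule: infinite_finite_induct) (auto intro: cong_p_add)

lemma cong_p_integral: "integral x" if xy: "x \<approx> y" and y: "integral y"
proof -
  obtain z where "integral z" "x - y = of_nat p * z" using xy unfolding cong_p_def by auto
  then have "x = of_nat p * z + y" by simp
  with y \<open>integral z\<close> show ?thesis by simp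
qed

lemma cong_p_power: "x ^ k \<approx> y ^ k" if "x \<approx> y" "integral y"
  using that cong_p_integral[OF that]
  by (induction k) (auto intro!: cong_p_mult)

lemma cong_p_cancel:
  assumes "of_nat k * x \<approx> of_nat k * y" "\<not> p dvd k"
  shows "x \<approx> y"
proof -
  have "k \<noteq> 0" using assms(2) by (metis dvd_0_right)
  then show ?thesis
    using cong_p_mult_left[OF assms(1) integral_inverse_of_nat[OF assms(2)]] by simp
qed

lemma multiple_p_cong_0: "of_nat p * x \<approx> 0" if "integral x"
  unfolding cong_p_def using that by auto

lemma not_dvd_less: "\<not> p dvd k" if "0 < k" "k < p"
  using that by (simp add: nat_dvd_not_less)

lemma not_dvd_fact: "\<not> p dvd fact k" if "k < p"
  using that prime by (simp add: prime_dvd_fact_iff)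

lemma integral_bounded_frac: "integral (of_nat x / of_nat k)" if "0 < k" "k < p"
  using that by (simp add: not_dvd_less)

text \<open>
  By the binomial theorem (m + 1)^p and m^p + 1 agree modulo p, so k^p is congruent to k by induction.
\<close>
lemma fermat_rat: "of_nat k ^ (p - 1) \<approx> 1" if k: "0 < k" "k < p"
proof -
  have "of_nat m ^ p \<approx> of_nat m" for m
  proof (induction m)
    case (Suc m)
    have "(of_nat (Suc m) :: rat) ^ p = (\<Sum>i\<le>p. of_nat (p choose i) * of_nat m ^ i)"
      using binomial_ring[of "of_nat m :: rat" 1 p] by (simp add: add.commute)
    also have "\<dots> \<approx> (\<Sum>i\<le>p. if i = 0 then 1 else if i = p then of_nat m else 0)"
    proof (rule cong_p_sum)
      fix i assume i: "i \<in> {..p}"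
      show "of_nat (p choose i) * of_nat m ^ i \<approx> (if i = 0 then 1 else if i = p then of_nat m else 0)"
      proof (cases "i = 0 \<or> i = p")
        case True
        then show ?thesis using Suc.IH p_pos by auto
      next
        case False
        then have "p dvd (p choose i)" using i prime by (intro dvd_choose_prime) auto
        then obtain c where "p choose i = p * c" by (elim dvdE)
        then show ?thesis using False multiple_p_cong_0[of "of_nat c * of_nat m ^ i"]
          by (simp add: mult.assoc)
      qed
    qed
    also have "\<dots> = of_nat (Suc m)"
      using p_pos by (simp add: sum.If_cases)
    finally show ?case .
  qed (simp add: p_pos zero_power)
  from this[of k] have "of_nat k * of_nat k ^ (p - 1) \<approx> of_nat k * 1"
    using power_minus_mult[OF p_pos, of "of_nat k :: rat"] by (simp add: mult.commute)
  then show ?thesis by (rule cong_p_cancel) (rule not_dvd_less[OF k])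
qed

lemma of_nat_reflect: "of_nat (p - k) \<approx> - of_nat k" if "k \<le> p"
  unfolding cong_p_def using that by (intro exI[of _ 1]) (auto simp: of_nat_diff)

text \<open>
  If x - y is c/d by quotient_of and p u/v with v prime to p, then c v = p u d; the multiplicities of p on
  both sides give the valuation.
\<close>
lemma rat_cong_if_cong_p:
  assumes "x \<approx> y" shows "rat_cong x y p"
proof (cases "x = y")
  case False
  obtain z where z: "integral z" "x - y = of_nat p * z" using assms unfolding cong_p_def by auto
  obtain u v where uv: "\<not> int p dvd v" "v \<noteq> 0" "z = of_int u / of_int v" using z(1) by (elim integralE)
  obtain c d where cd: "quotient_of (x - y) = (c, d)" by fastforce
  have d: "d > 0" using cd quotient_of_denom_pos by blast
  have eq: "x - y = of_int c / of_int d" using cd quotient_of_div by blast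
  have "of_int (c * v) = (of_int (int p * u * d) :: rat)"
    using eq z(2) uv d by (simp add: field_simps)
  then have cv: "c * v = int p * u * d" by (simp only: of_int_eq_iff)
  have nz: "u \<noteq> 0" "c \<noteq> 0" using False z(2) uv(3) eq by auto
  have "multiplicity (int p) (c * v) = multiplicity (int p) c"
    using prime_int uv nz by (simp add: prime_elem_multiplicity_mult_distrib not_dvd_imp_multiplicity_0)
  moreover have "multiplicity (int p) (int p * u * d) = 1 + multiplicity (int p) u + multiplicity (int p) d"
    using prime_int uv nz d by (simp add: prime_elem_multiplicity_mult_distrib)
  ultimately have "multiplicity (int p) c = 1 + multiplicity (int p) u + multiplicity (int p) d"
    using cv by simp
  then show ?thesis unfolding rat_cong_def padic_valuation_def cd by simp
qed (simp add: rat_cong_def)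

section \<open>Power sums and recovery of coefficients from values at squares\<close>

lemma power_sum_recursion:
  "(\<Sum>i\<le>r. of_nat (Suc r choose i) * (\<Sum>m<N. of_nat m ^ i)) = (of_nat N ^ Suc r :: rat)"
proof -
  have "(\<Sum>i\<le>r. of_nat (Suc r choose i) * (of_nat m :: rat) ^ i) = of_nat (Suc m) ^ Suc r - of_nat m ^ Suc r" for m
    using binomial_ring[of "of_nat m :: rat" 1 "Suc r"] by (simp add: add.commute)
  then have "(\<Sum>m<N. \<Sum>i\<le>r. of_nat (Suc r choose i) * (of_nat m :: rat) ^ i) = of_nat N ^ Suc r"
    using sum_lessThan_telescope[of "\<lambda>m. (of_nat m :: rat) ^ Suc r" N] by simp
  then show ?thesis by (subst (asm) sum.swap) (simp add: sum_distrib_left)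
qed

text \<open>
  In the recursion for the power sums the leading coefficient r + 1 is invertible as long as r < p - 1,
  and all other terms are divisible by p by induction.
\<close>
lemma power_sum_cong_0: "(\<Sum>m<p. of_nat m ^ r) \<approx> 0" if "r < p - 1"
  using that
proof (induction r rule: less_induct)
  case (less r)
  have "(\<Sum>i<r. of_nat (Suc r choose i) * (\<Sum>m<p. of_nat m ^ i)) \<approx> (\<Sum>i<r. of_nat (Suc r choose i) * 0)"
    by (intro cong_p_sum cong_p_mult_left less.IH) (use less.prems in auto)
  moreover have "of_nat p ^ Suc r \<approx> 0"
    using multiple_p_cong_0[of "of_nat p ^ r"] by auto
  ultimately have "of_nat p ^ Suc r - (\<Sum>i<r. of_nat (Suc r choose i) * (\<Sum>m<p. of_nat m ^ i)) \<approx> 0 - 0"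
    by (intro cong_p_diff) auto
  moreover have "of_nat p ^ Suc r - (\<Sum>i<r. of_nat (Suc r choose i) * (\<Sum>m<p. of_nat m ^ i))
      = (of_nat (Suc r) * (\<Sum>m<p. of_nat m ^ r) :: rat)"
    unfolding power_sum_recursion[of r p, symmetric] lessThan_Suc_atMost[symmetric] by simp
  ultimately have "of_nat (Suc r) * (\<Sum>m<p. of_nat m ^ r) \<approx> of_nat (Suc r) * 0" by simp
  then show ?case by (rule cong_p_cancel) (use less.prems not_dvd_less[of "Suc r"] in auto)
qed

lemma sum_reflect_halves:
  "(\<Sum>k\<in>{1..p-1}. f k) = (\<Sum>k\<in>{1..half}. f k + f (p - k))" for f :: "nat \<Rightarrow> rat"
proof -
  have "{1..p-1} = {1..half} \<union> {half+1..2*half}" "{1..half} \<inter> {half+1..2*half} = {}" using p_eq by auto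
  then have "(\<Sum>k\<in>{1..p-1}. f k) = (\<Sum>k\<in>{1..half}. f k) + (\<Sum>k\<in>{half+1..2*half}. f k)"
    by (simp add: sum.union_disjoint)
  also have "(\<Sum>k\<in>{half+1..2*half}. f k) = (\<Sum>k\<in>{1..half}. f (p - k))"
    by (rule sum.reindex_bij_witness[of _ "\<lambda>k. p - k" "\<lambda>k. p - k"]) (use p_eq in auto)
  finally show ?thesis by (simp add: sum.distrib)
qed

text \<open>
  The range of u is just large enough for the differences of exponents that occur when a polynomial of
  degree at most half in m^2 is paired with a power of m^2.
\<close>
lemma even_half_power_sum:
  assumes "0 < u" "u < 2 * half"
  shows "2 * (\<Sum>m\<in>{1..half}. of_nat m ^ (2 * u)) \<approx> (if u = half then - 1 else 0)"
proof -
  have "(\<Sum>m\<in>{1..p-1}. of_nat m ^ (2 * u)) \<approx> (\<Sum>m\<in>{1..half}. of_nat m ^ (2 * u) + (- of_nat m) ^ (2 * u))"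
    unfolding sum_reflect_halves
    by (intro cong_p_sum cong_p_add cong_p_refl cong_p_power of_nat_reflect integral_uminus) (use p_eq in auto)
  then have *: "(\<Sum>m\<in>{1..p-1}. of_nat m ^ (2 * u)) \<approx> 2 * (\<Sum>m\<in>{1..half}. of_nat m ^ (2 * u))"
    by (simp add: sum_distrib_left)
  have full: "(\<Sum>m<p. of_nat m ^ i) = (\<Sum>m\<in>{1..p-1}. of_nat m ^ i :: rat)" if "i > 0" for i
    by (rule sum.mono_neutral_right) (use that p_eq in \<open>auto simp: Suc_le_eq\<close>)
  have "(\<Sum>m\<in>{1..p-1}. of_nat m ^ (2 * u)) \<approx> (if u = half then - 1 else 0)"
  proof -
    consider "u < half" | "u = half" | "u > half" by linarith
    then show ?thesis
    proof cases
      case 1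
      then show ?thesis using power_sum_cong_0[of "2 * u"] full[of "2 * u"] p_eq assms by simp
    next
      case 2
      have "(\<Sum>m\<in>{1..p-1}. of_nat m ^ (2 * u)) \<approx> (\<Sum>m\<in>{1..p-1}. 1)"
      proof (rule cong_p_sum)
        fix m assume "m \<in> {1..p-1}"
        then have "0 < m" "m < p" by auto
        moreover have "2 * u = p - 1" using 2 p_eq by simp
        ultimately show "of_nat m ^ (2 * u) \<approx> 1" using fermat_rat[of m] by simp
      qed
      also have "(\<Sum>m\<in>{1..p-1}. 1) = (of_nat (p - 1) :: rat)" by simp
      also have "\<dots> \<approx> - of_nat 1" by (rule of_nat_reflect) (use p_eq in auto)
      finally show ?thesis using 2 by simp
    next
      case 3
      \<comment> \<open>by Fermat the exponent can be lowered by p - 1 into the range of vanishing sums\<close>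
      define w where "w = u - half"
      have w: "u = half + w" "0 < w" "w < half" using 3 assms by (auto simp: w_def)
      have "(\<Sum>m\<in>{1..p-1}. of_nat m ^ (2 * u)) \<approx> (\<Sum>m\<in>{1..p-1}. of_nat m ^ (2 * w))"
      proof (rule cong_p_sum)
        fix m assume m: "m \<in> {1..p-1}"
        have "of_nat m ^ (2 * w) * of_nat m ^ (p - 1) \<approx> of_nat m ^ (2 * w) * 1"
          by (intro cong_p_mult_left fermat_rat integral_power) (use m p_eq in auto)
        moreover have "2 * w + (p - 1) = 2 * u" using w p_eq by simp
        then have "of_nat m ^ (2 * w) * of_nat m ^ (p - 1) = (of_nat m ^ (2 * u) :: rat)"
          by (simp only: power_add[symmetric])
        ultimately show "of_nat m ^ (2 * u) \<approx> of_nat m ^ (2 * w)" by simp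
      qed
      also have "\<dots> \<approx> 0" using power_sum_cong_0[of "2 * w"] full[of "2 * w"] p_eq w by simp
      finally show ?thesis using 3 by simp
    qed
  qed
  with * show ?thesis using cong_p_sym cong_p_trans by blast
qed

text \<open>
  Orthogonality of the power sums over the nonzero squares.  The weight m^(2(half - a)) stands for
  m^(-2a).  Since m^(2 half) is congruent to 1, the coefficients of degree 0 and half cannot be told
  apart, so degree half is admitted only if a is not 0.
\<close>
lemma coefficient_extraction:
  assumes deg: "\<And>i. i \<ge> half \<Longrightarrow> i \<noteq> half \<or> a = 0 \<Longrightarrow> coeff q i = 0"
    and int: "\<And>i. integral (coeff q i)" and a: "a < half"
  shows "coeff q a \<approx> - 2 * (\<Sum>m\<in>{1..half}. poly q (of_nat m ^ 2) * of_nat m ^ (2 * (half - a)))"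
proof -
  define S where "S c = (\<Sum>m\<in>{1..half}. of_nat m ^ (2 * (half - a + c)) :: rat)" for c
  have deg': "coeff q i = 0" if "i > half" for i using that deg[of i] by auto
  have ev: "poly q x = (\<Sum>c\<le>half. coeff q c * x ^ c)" for x
  proof -
    have "degree q \<le> half" by (rule degree_le) (use deg' in auto)
    then show ?thesis unfolding poly_altdef
      by (intro sum.mono_neutral_left) (auto simp: coeff_eq_0)
  qed
  have "(\<Sum>m\<in>{1..half}. poly q (of_nat m ^ 2) * of_nat m ^ (2 * (half - a)))
     = (\<Sum>m\<in>{1..half}. \<Sum>c\<le>half. coeff q c * of_nat m ^ (2 * (half - a + c)))"
    unfolding ev sum_distrib_right
    by (intro sum.cong refl) (simp add: power_add distrib_left flip: power_mult)
  also have "\<dots> = (\<Sum>c\<le>half. coeff q c * S c)"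
    unfolding S_def sum_distrib_left by (rule sum.swap)
  finally have **: "(\<Sum>m\<in>{1..half}. poly q (of_nat m ^ 2) * of_nat m ^ (2 * (half - a))) = (\<Sum>c\<le>half. coeff q c * S c)" .
  have *: "- 2 * (\<Sum>m\<in>{1..half}. poly q (of_nat m ^ 2) * of_nat m ^ (2 * (half - a)))
     = (\<Sum>c\<le>half. - coeff q c * (2 * S c))"
    unfolding ** sum_distrib_left by (intro sum.cong) auto
  have "(\<Sum>c\<le>half. - coeff q c * (2 * S c)) \<approx> (\<Sum>c\<le>half. - coeff q c * (if c = a then - 1 else 0))"
  proof (rule cong_p_sum)
    fix c assume c: "c \<in> {..half}"
    show "- coeff q c * (2 * S c) \<approx> - coeff q c * (if c = a then - 1 else 0)"
    proof (cases "c = half \<and> a = 0")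
      case True
      then show ?thesis using deg[of half] by simp
    next
      case False
      have "2 * S c \<approx> (if half - a + c = half then - 1 else 0)" unfolding S_def
        by (rule even_half_power_sum) (use False c a in auto)
      moreover have "half - a + c = half \<longleftrightarrow> c = a" using a by auto
      ultimately show ?thesis by (intro cong_p_mult_left) (use int in auto)
    qed
  qed
  also have "(\<Sum>c\<le>half. - coeff q c * (if c = a then - 1 else 0)) = (\<Sum>c\<le>half. if c = a then coeff q c else 0)"
    by (intro sum.cong) auto
  also have "\<dots> = coeff q a" using a by (simp add: sum.delta')
  finally show ?thesis unfolding * by (rule cong_p_sym)
qed

end

section \<open>Multiple harmonic sums as coefficients of generating functions\<close>
lemma multiple_harmonic_sum_Nil [simp]: "multiple_harmonic_sum [] n = 1"
  and multiple_harmonic_star_sum_Nil [simp]: "multiple_harmonic_star_sum [] n = 1"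
proof -
  have "{k. length k = length ([]::nat list) \<and> set k \<subseteq> {1..n} \<and> sorted_wrt R k} = {[]}" for R
    by auto
  then show "multiple_harmonic_sum [] n = 1" "multiple_harmonic_star_sum [] n = 1"
    unfolding multiple_harmonic_sum_def multiple_harmonic_star_sum_def by simp_all
qed

text \<open>
  Splitting off the last entry k of a monotone tuple, uniformly for strict and weak monotonicity: the
  remaining entries are bounded by m k, which is k - 1 or k.
\<close>
lemma sum_lists_snoc:
  fixes R :: "nat \<Rightarrow> nat \<Rightarrow> bool" and s :: "nat list" and m :: "nat \<Rightarrow> nat"
  defines "L \<equiv> \<lambda>s n. {k. length k = length s \<and> set k \<subseteq> {1..n} \<and> sorted_wrt R k}"
  assumes R: "\<And>i k. k \<in> {1..n} \<Longrightarrow> i \<in> {1..n} \<and> R i k \<longleftrightarrow> i \<in> {1..m k}"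
  shows "(\<Sum>k\<in>L (s @ [c]) n. 1 / (\<Prod>i<length (s @ [c]). of_nat (k ! i) ^ ((s @ [c]) ! i)) :: rat)
    = (\<Sum>k\<in>{1..n}. (\<Sum>k\<in>L s (m k). 1 / (\<Prod>i<length s. of_nat (k ! i) ^ (s ! i))) / of_nat k ^ c)"
proof -
  have fin: "finite (L s n)" for s n
    unfolding L_def by (rule finite_subset[OF _ finite_lists_length_eq[of "{1..n}" "length s"]]) auto
  have "(\<Sum>k\<in>L (s @ [c]) n. 1 / (\<Prod>i<length (s @ [c]). of_nat (k ! i) ^ ((s @ [c]) ! i)) :: rat)
      = (\<Sum>(k, l)\<in>(SIGMA k:{1..n}. L s (m k)). 1 / (\<Prod>i<length s. of_nat (l ! i) ^ (s ! i)) / of_nat k ^ c)"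
  proof (rule sum.reindex_bij_witness[of _ "\<lambda>(k, l). l @ [k]" "\<lambda>l. (last l, butlast l)"])
    fix l assume l: "l \<in> L (s @ [c]) n"
    then have len: "length l = Suc (length s)" by (auto simp: L_def)
    then obtain xs x where xs: "l = xs @ [x]" by (metis append_butlast_last_id length_0_conv nat.simps(3))
    show "(case (last l, butlast l) of (k, l) \<Rightarrow> l @ [k]) = l" using xs by simp
    have x: "x \<in> {1..n}" and "length xs = length s" "set xs \<subseteq> {1..n}" "sorted_wrt R xs" "\<forall>i\<in>set xs. R i x"
      using l len xs by (auto simp: L_def sorted_wrt_append)
    then have "xs \<in> L s (m x)" unfolding L_def using R[OF x] by blast
    then show "(last l, butlast l) \<in> (SIGMA k:{1..n}. L s (m k))" using xs x by simp
    show "(case (last l, butlast l) of (k, l) \<Rightarrow> 1 / (\<Prod>i<length s. of_nat (l ! i) ^ (s ! i)) / of_nat k ^ c)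
       = (1 / (\<Prod>i<length (s @ [c]). of_nat (l ! i) ^ ((s @ [c]) ! i)) :: rat)"
    proof -
      have "(\<Prod>i<length s. of_nat (l ! i) ^ ((s @ [c]) ! i)) = (\<Prod>i<length s. of_nat (xs ! i) ^ (s ! i) :: rat)"
        by (rule prod.cong) (use xs len in \<open>auto simp: nth_append\<close>)
      then show ?thesis using xs len by (simp add: nth_append)
    qed
  next
    fix q assume q: "q \<in> (SIGMA k:{1..n}. L s (m k))"
    obtain x xs where xs: "q = (x, xs)" by force
    have x: "x \<in> {1..n}" and l: "length xs = length s" "set xs \<subseteq> {1..m x}" "sorted_wrt R xs"
      using q xs by (auto simp: L_def)
    have "\<forall>i\<in>set xs. i \<in> {1..n} \<and> R i x" using l R[OF x] by blast
    then show "(case q of (k, l) \<Rightarrow> l @ [k]) \<in> L (s @ [c]) n"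
      using x l xs by (auto simp: L_def sorted_wrt_append)
    show "(last (case q of (k, l) \<Rightarrow> l @ [k]), butlast (case q of (k, l) \<Rightarrow> l @ [k])) = q" using xs by simp
  qed
  also have "\<dots> = (\<Sum>k\<in>{1..n}. \<Sum>l\<in>L s (m k). 1 / (\<Prod>i<length s. of_nat (l ! i) ^ (s ! i)) / of_nat k ^ c)"
    by (rule sum.Sigma[symmetric]) (use fin in auto)
  finally show ?thesis by (simp add: sum_divide_distrib)
qed

lemma multiple_harmonic_sum_snoc:
  "multiple_harmonic_sum (s @ [c]) n = (\<Sum>k\<in>{1..n}. multiple_harmonic_sum s (k - 1) / of_nat k ^ c)"
  unfolding multiple_harmonic_sum_def by (rule sum_lists_snoc) auto

lemma multiple_harmonic_star_sum_snoc:
  "multiple_harmonic_star_sum (s @ [c]) n = (\<Sum>k\<in>{1..n}. multiple_harmonic_star_sum s k / of_nat k ^ c)"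
  unfolding multiple_harmonic_star_sum_def by (rule sum_lists_snoc) auto

lemma multiple_harmonic_sum_snoc_Suc:
  "multiple_harmonic_sum (s @ [c]) (Suc n)
     = multiple_harmonic_sum (s @ [c]) n + multiple_harmonic_sum s n / of_nat (Suc n) ^ c"
  unfolding multiple_harmonic_sum_snoc by simp

lemma multiple_harmonic_star_sum_snoc_Suc:
  "multiple_harmonic_star_sum (s @ [c]) (Suc n)
     = multiple_harmonic_star_sum (s @ [c]) n + multiple_harmonic_star_sum s (Suc n) / of_nat (Suc n) ^ c"
  unfolding multiple_harmonic_star_sum_snoc by simp

text \<open>
  Up to signs, the coefficients of elementary_gf k n and complete_gf k n are the elementary and the
  complete homogeneous symmetric functions of 1/j^2 for k < j \<le> n.
\<close>
definition elementary_gf :: "nat \<Rightarrow> nat \<Rightarrow> rat fps" where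
  "elementary_gf k n = (\<Prod>j\<in>{k<..n}. 1 - fps_const (1 / of_nat j ^ 2) * fps_X)"

definition complete_gf :: "nat \<Rightarrow> nat \<Rightarrow> rat fps" where
  "complete_gf k n = (\<Prod>j\<in>{k<..n}. Abs_fps (\<lambda>i. (1 / of_nat j ^ 2) ^ i))"

lemma elementary_gf_self [simp]: "elementary_gf n n = 1"
  and complete_gf_self [simp]: "complete_gf n n = 1"
  by (simp_all add: elementary_gf_def complete_gf_def)

lemma geometric_fps: "Abs_fps (\<lambda>i. c ^ i) * (1 - fps_const c * fps_X) = (1 :: rat fps)"
proof (rule fps_ext)
  fix i show "(Abs_fps (\<lambda>i. c ^ i) * (1 - fps_const c * fps_X)) $ i = (1 :: rat fps) $ i"
    by (cases i) (simp_all add: algebra_simps)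
qed

lemma elementary_gf_mult_complete_gf: "elementary_gf k n * complete_gf k n = 1"
  unfolding elementary_gf_def complete_gf_def
    prod.distrib[symmetric]
  by (intro prod.neutral ballI) (subst mult.commute, rule geometric_fps)

lemma elementary_gf_split: "elementary_gf i k * elementary_gf k n = elementary_gf i n" if "i \<le> k" "k \<le> n"
proof -
  have "{i<..n} = {i<..k} \<union> {k<..n}" "{i<..k} \<inter> {k<..n} = {}" using that by auto
  then show ?thesis unfolding elementary_gf_def by (simp add: prod.union_disjoint)
qed

lemma greaterThanAtMost_Suc: "{k<..Suc n} = insert (Suc n) {k<..n}" if "k \<le> n" for k n :: nat
  using that by auto

lemma elementary_gf_nth_Suc:
  assumes "k \<le> n"
  shows "elementary_gf k (Suc n) $ Suc i
    = elementary_gf k n $ Suc i - elementary_gf k n $ i / of_nat (Suc n) ^ 2"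
proof -
  have "elementary_gf k (Suc n) = elementary_gf k n - fps_const (1 / of_nat (Suc n) ^ 2) * (fps_X * elementary_gf k n)"
    unfolding elementary_gf_def greaterThanAtMost_Suc[OF assms] by (simp add: algebra_simps)
  then show ?thesis by simp
qed

lemma elementary_gf_nth_0 [simp]: "elementary_gf k n $ 0 = 1"
proof -
  have "(\<Prod>j\<in>A. 1 - fps_const (1 / of_nat j ^ 2) * fps_X :: rat fps) $ 0 = 1" for A :: "nat set"
    by (induction A rule: infinite_finite_induct) simp_all
  then show ?thesis unfolding elementary_gf_def .
qed

lemma complete_gf_nth_Suc:
  assumes "k \<le> n"
  shows "complete_gf k (Suc n) $ Suc i
    = complete_gf k n $ Suc i + complete_gf k (Suc n) $ i / of_nat (Suc n) ^ 2"
proof -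
  let ?c = "1 / of_nat (Suc n) ^ 2 :: rat"
  have "complete_gf k (Suc n) * (1 - fps_const ?c * fps_X)
      = (Abs_fps (\<lambda>i. ?c ^ i) * (1 - fps_const ?c * fps_X)) * complete_gf k n"
    unfolding complete_gf_def greaterThanAtMost_Suc[OF assms] by (simp add: ac_simps)
  then have "complete_gf k n = complete_gf k (Suc n) - fps_const ?c * (fps_X * complete_gf k (Suc n))"
    unfolding geometric_fps by (simp add: algebra_simps)
  from arg_cong[OF this, of "\<lambda>f. f $ Suc i"] show ?thesis by simp
qed

lemma complete_gf_nth_0 [simp]: "complete_gf k n $ 0 = 1"
  using arg_cong[OF elementary_gf_mult_complete_gf[of k n], of "\<lambda>f. f $ 0"] by simp

lemma multiple_harmonic_sum_twos:
  "multiple_harmonic_sum (replicate a 2) n = (- 1) ^ a * elementary_gf 0 n $ a"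
proof (induction n arbitrary: a)
  case 0
  then show ?case
    by (cases a) (simp_all add: multiple_harmonic_sum_snoc replicate_append_same[symmetric])
next
  case (Suc n)
  show ?case
  proof (cases a)
    case (Suc a')
    then show ?thesis
      using multiple_harmonic_sum_snoc_Suc[of "replicate a' 2" 2 n] Suc.IH[of a] Suc.IH[of a']
      by (simp add: replicate_append_same elementary_gf_nth_Suc algebra_simps)
  qed simp
qed

lemma multiple_harmonic_star_sum_twos:
  "multiple_harmonic_star_sum (replicate a 2) n = complete_gf 0 n $ a"
proof (induction n arbitrary: a)
  case 0
  then show ?case
    by (cases a) (simp_all add: multiple_harmonic_star_sum_snoc replicate_append_same[symmetric])
next
  case (Suc n)
  show ?case
  proof (induction a)
    case (Suc a)
    then show ?case
      using multiple_harmonic_star_sum_snoc_Suc[of "replicate a 2" 2 n] Suc.IH \<open>\<And>a. multiple_harmonic_star_sum (replicate a 2) n = complete_gf 0 n $ a\<close>[of "Suc a"]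
      by (simp add: replicate_append_same complete_gf_nth_Suc)
  qed simp
qed

text \<open>
  In both expansions below, k is the entry of the tuple that carries the exponent 1; the other two
  factors collect the entries before and after it.
\<close>
lemma multiple_harmonic_sum_twos_one_twos:
  "multiple_harmonic_sum (replicate a 2 @ [1] @ replicate b 2) n
     = (- 1) ^ (a + b) * (\<Sum>k\<in>{1..n}. elementary_gf 0 (k - 1) $ a * elementary_gf k n $ b / of_nat k)"
proof (induction n arbitrary: b)
  case 0
  then show ?case
  proof (cases b)
    case (Suc b')
    then show ?thesis using multiple_harmonic_sum_snoc[of "replicate a 2 @ [1] @ replicate b' 2" 2 0]
      by (simp add: replicate_append_same)
  qed (use multiple_harmonic_sum_snoc[of "replicate a 2" 1 0] in simp)
next
  case (Suc n)
  show ?case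
  proof (cases b)
    case 0
    then show ?thesis
      using multiple_harmonic_sum_snoc_Suc[of "replicate a 2" 1 n] Suc.IH[of 0]
      by (simp add: multiple_harmonic_sum_twos algebra_simps)
  next
    case b: (Suc b')
    have "(\<Sum>k\<in>{1..Suc n}. elementary_gf 0 (k - 1) $ a * elementary_gf k (Suc n) $ b / of_nat k)
        = (\<Sum>k\<in>{1..n}. elementary_gf 0 (k - 1) $ a * elementary_gf k (Suc n) $ b / of_nat k)"
      using b by simp
    also have "\<dots> = (\<Sum>k\<in>{1..n}. elementary_gf 0 (k - 1) $ a * elementary_gf k n $ b / of_nat k
        - elementary_gf 0 (k - 1) $ a * elementary_gf k n $ b' / of_nat k / of_nat (Suc n) ^ 2)"
      by (rule sum.cong) (auto simp: b elementary_gf_nth_Suc diff_divide_distrib right_diff_distrib mult.commute)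
    also have "\<dots> = (\<Sum>k\<in>{1..n}. elementary_gf 0 (k - 1) $ a * elementary_gf k n $ b / of_nat k)
        - (\<Sum>k\<in>{1..n}. elementary_gf 0 (k - 1) $ a * elementary_gf k n $ b' / of_nat k) / of_nat (Suc n) ^ 2"
      by (simp only: sum_subtractf sum_divide_distrib)
    finally show ?thesis
      using multiple_harmonic_sum_snoc_Suc[of "replicate a 2 @ [1] @ replicate b' 2" 2 n] Suc.IH[of b] Suc.IH[of b']
      by (simp add: b replicate_append_same right_diff_distrib)
  qed
qed

lemma multiple_harmonic_star_sum_twos_one_twos:
  "multiple_harmonic_star_sum (replicate a 2 @ [1] @ replicate b 2) n
     = (\<Sum>k\<in>{1..n}. complete_gf 0 k $ a * complete_gf (k - 1) n $ b / of_nat k)"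
proof (induction n arbitrary: b)
  case 0
  then show ?case
  proof (cases b)
    case (Suc b')
    then show ?thesis using multiple_harmonic_star_sum_snoc[of "replicate a 2 @ [1] @ replicate b' 2" 2 0]
      by (simp add: replicate_append_same)
  qed (use multiple_harmonic_star_sum_snoc[of "replicate a 2" 1 0] in simp)
next
  case (Suc n)
  note IH = this
  show ?case
  proof (induction b)
    case 0
    then show ?case
      using multiple_harmonic_star_sum_snoc_Suc[of "replicate a 2" 1 n] IH[of 0]
      by (simp add: multiple_harmonic_star_sum_twos)
  next
    case (Suc b)
    have "(\<Sum>k\<in>{1..Suc n}. complete_gf 0 k $ a * complete_gf (k - 1) (Suc n) $ Suc b / of_nat k)
        = (\<Sum>k\<in>{1..Suc n}. complete_gf 0 k $ a * complete_gf (k - 1) n $ Suc b / of_nat k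
        + complete_gf 0 k $ a * complete_gf (k - 1) (Suc n) $ b / of_nat k / of_nat (Suc n) ^ 2)"
      by (rule sum.cong) (auto simp: complete_gf_nth_Suc add_divide_distrib distrib_left mult.commute)
    also have "\<dots> = (\<Sum>k\<in>{1..n}. complete_gf 0 k $ a * complete_gf (k - 1) n $ Suc b / of_nat k)
        + (\<Sum>k\<in>{1..Suc n}. complete_gf 0 k $ a * complete_gf (k - 1) (Suc n) $ b / of_nat k) / of_nat (Suc n) ^ 2"
      unfolding sum.distrib sum_divide_distrib by simp
    finally show ?case
      using multiple_harmonic_star_sum_snoc_Suc[of "replicate a 2 @ [1] @ replicate b 2" 2 n] IH[of "Suc b"] Suc.IH
      by (simp add: replicate_append_same)
  qed
qed

text \<open>
  The same product as a polynomial, so that it can be evaluated.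
\<close>
definition elementary_poly :: "nat \<Rightarrow> nat \<Rightarrow> rat poly" where
  "elementary_poly k n = (\<Prod>j\<in>{k<..n}. [:1, - (1 / of_nat j ^ 2):])"

lemma coeff_elementary_poly: "coeff (elementary_poly k n) i = elementary_gf k n $ i"
proof -
  have "fps_of_poly (elementary_poly k n) = elementary_gf k n"
    unfolding elementary_poly_def elementary_gf_def fps_of_poly_prod
    by (intro prod.cong refl) (simp add: fps_of_poly_pCons mult.commute flip: fps_const_neg)
  then show ?thesis by (metis fps_of_poly_nth)
qed

lemma poly_elementary_poly: "poly (elementary_poly k n) x = (\<Prod>j\<in>{k<..n}. 1 - x / of_nat j ^ 2)"
  unfolding elementary_poly_def by (simp add: poly_prod)

lemma degree_elementary_poly: "degree (elementary_poly k n) \<le> n - k"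
proof -
  have "degree (elementary_poly k n) \<le> (\<Sum>j\<in>{k<..n}. degree [:1, - (1 / of_nat j ^ 2) :: rat:])"
    unfolding elementary_poly_def using degree_prod_sum_le[of "{k<..n}" "\<lambda>j. [:1, - (1 / of_nat j ^ 2) :: rat:]"] by (simp add: o_def)
  also have "\<dots> \<le> (\<Sum>j\<in>{k<..n}. 1)" by (rule sum_mono) simp
  finally show ?thesis by simp
qed

text \<open>
  Both multiple harmonic sums of the theorem reduce modulo p to this sum.
\<close>
definition mixed_sum :: "nat \<Rightarrow> nat \<Rightarrow> nat \<Rightarrow> rat" where
  "mixed_sum n a b = (\<Sum>k\<in>{1..n}. 1 / of_nat k * (elementary_gf 0 (k - 1) $ a * complete_gf 0 k $ b))"

section \<open>Reduction of both sums to the mixed sum\<close>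
context odd_prime
begin

definition integral_fps :: "rat fps \<Rightarrow> bool" where
  "integral_fps f \<longleftrightarrow> (\<forall>i. integral (f $ i))"

lemma integral_fps_mult: "integral_fps (f * g)" if "integral_fps f" "integral_fps g"
  using that unfolding integral_fps_def fps_mult_nth by (auto intro!: integral_sum)

lemma integral_fps_prod: "integral_fps (\<Prod>j\<in>A. f j)" if "\<And>j. j \<in> A \<Longrightarrow> integral_fps (f j)"
  using that
proof (induction A rule: infinite_finite_induct)
  case (insert x A)
  then show ?case by (simp add: integral_fps_mult)
qed (auto simp: integral_fps_def)

lemma integral_inverse_square: "integral (1 / of_nat j ^ 2)" if "0 < j" "j < p"
  using integral_power[OF integral_bounded_frac[OF that, of 1], of 2] by (simp add: power_one_over)

lemma integral_fps_linear: "integral_fps (1 - fps_const c * fps_X)" if "integral c"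
  using that unfolding integral_fps_def by (auto simp: fps_one_nth)

lemma integral_elementary_gf: "integral_fps (elementary_gf k n)" if "n < p"
  unfolding elementary_gf_def
  by (intro integral_fps_prod integral_fps_linear integral_inverse_square) (use that in auto)

lemma integral_complete_gf: "integral_fps (complete_gf k n)" if "n < p"
  unfolding complete_gf_def
proof (intro integral_fps_prod)
  fix j assume "j \<in> {k<..n}"
  then show "integral_fps (Abs_fps (\<lambda>i. (1 / of_nat j ^ 2) ^ i))"
    unfolding integral_fps_def using integral_power[OF integral_inverse_square[of j]] that by auto
qed

definition cong_fps :: "rat fps \<Rightarrow> rat fps \<Rightarrow> bool" where
  "cong_fps f g \<longleftrightarrow> (\<forall>i. f $ i \<approx> g $ i)"

lemma cong_fps_prod:
  assumes "\<And>j. j \<in> A \<Longrightarrow> cong_fps (f j) (g j)" "\<And>j. j \<in> A \<Longrightarrow> integral_fps (f j)" "\<And>j. j \<in> A \<Longrightarrow> integral_fps (g j)"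
  shows "cong_fps (\<Prod>j\<in>A. f j) (\<Prod>j\<in>A. g j)"
  using assms
proof (induction A rule: infinite_finite_induct)
  case (insert x A)
  have "cong_fps (prod f A) (prod g A)" "cong_fps (f x) (g x)" using insert by auto
  moreover have "integral_fps (prod f A)" "integral_fps (g x)"
    using insert by (auto intro: integral_fps_prod)
  ultimately have "cong_fps (f x * prod f A) (g x * prod g A)"
    unfolding cong_fps_def integral_fps_def fps_mult_nth by (auto intro!: cong_p_sum cong_p_mult)
  then show ?case using insert by simp
qed (auto simp: cong_fps_def)

lemma inverse_reflect: "1 / of_nat (p - k) \<approx> - (1 / of_nat k)" if "0 < k" "k < p"
  unfolding cong_p_def
proof (intro exI[of _ "(1 / of_nat (p - k)) * (1 / of_nat k)"] conjI)
  show "integral ((1 / of_nat (p - k)) * (1 / of_nat k))"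
    using that not_dvd_less[of k] not_dvd_less[of "p - k"] by (intro integral_mult integral_inverse_of_nat) auto
  show "1 / of_nat (p - k) - - (1 / of_nat k) = of_nat p * (1 / of_nat (p - k) * (1 / of_nat k) :: rat)"
    using that by (simp add: of_nat_diff field_simps)
qed

lemma inverse_square_reflect: "1 / of_nat (p - k) ^ 2 \<approx> 1 / of_nat k ^ 2" if "0 < k" "k < p"
  using cong_p_power[OF inverse_reflect[OF that], of 2] integral_bounded_frac[OF that, of 1]
  by (simp add: power_one_over)

text \<open>
  The substitution j \<mapsto> p - j preserves 1/j^2 modulo p.
\<close>
lemma elementary_gf_reflect:
  assumes "k < p"
  shows "elementary_gf 0 (p - 1 - k) $ i \<approx> elementary_gf k (p - 1) $ i"
proof -
  have "elementary_gf k (p - 1) = (\<Prod>j\<in>{0<..p-1-k}. 1 - fps_const (1 / of_nat (p - j) ^ 2) * fps_X)"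
    unfolding elementary_gf_def
    by (rule prod.reindex_bij_witness[of _ "\<lambda>k. p - k" "\<lambda>k. p - k"]) (use assms in auto)
  moreover have "cong_fps (\<Prod>j\<in>{0<..p-1-k}. 1 - fps_const (1 / of_nat j ^ 2) * fps_X)
      (\<Prod>j\<in>{0<..p-1-k}. 1 - fps_const (1 / of_nat (p - j) ^ 2) * fps_X)"
  proof (rule cong_fps_prod)
    fix j assume "j \<in> {0<..p-1-k}"
    then have j: "0 < j" "j < p" by auto
    show "cong_fps (1 - fps_const (1 / of_nat j ^ 2) * fps_X) (1 - fps_const (1 / of_nat (p - j) ^ 2) * fps_X)"
      using cong_p_uminus[OF cong_p_sym[OF inverse_square_reflect[OF j]]]
      unfolding cong_fps_def by (auto simp: fps_one_nth)
    show "integral_fps (1 - fps_const (1 / of_nat j ^ 2) * fps_X)"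
      using j by (intro integral_fps_linear integral_inverse_square)
    show "integral_fps (1 - fps_const (1 / of_nat (p - j) ^ 2) * fps_X)"
      using j by (intro integral_fps_linear integral_inverse_square) auto
  qed
  ultimately show ?thesis unfolding cong_fps_def elementary_gf_def by simp
qed

text \<open>
  A single vanishing factor suffices since the other factors are p-integral.
\<close>
lemma elementary_poly_vanishes_mod_p:
  assumes "n < p" "m \<le> p" "j \<in> {k<..n}" "1 - of_nat m ^ 2 / of_nat j ^ 2 \<approx> 0"
  shows "poly (elementary_poly k n) (of_nat m ^ 2) \<approx> 0"
proof -
  have int: "integral (1 - of_nat m ^ 2 / of_nat i ^ 2)" if "i \<in> {k<..n}" for i
    using integral_mult[OF integral_power[OF integral_of_nat[of m]] integral_inverse_square[of i], of 2] that assms by simp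
  have "integral (\<Prod>i\<in>{k<..n} - {j}. 1 - of_nat m ^ 2 / of_nat i ^ 2)"
    using int by (intro integral_prod) auto
  then have "(\<Prod>i\<in>{k<..n} - {j}. 1 - of_nat m ^ 2 / of_nat i ^ 2) * (1 - of_nat m ^ 2 / of_nat j ^ 2)
      \<approx> (\<Prod>i\<in>{k<..n} - {j}. 1 - of_nat m ^ 2 / of_nat i ^ 2) * 0"
    using assms by (intro cong_p_mult_left)
  then show ?thesis unfolding poly_elementary_poly
    using assms(3) by (subst prod.remove[of _ j]) (auto simp: mult.commute)
qed

text \<open>
  Either half of the product over 0 < j < p has degree half in the variable and vanishes modulo p at
  every m^2: the lower half contains the factor with j = m, the upper half the one with j = p - m.
  Its intermediate coefficients are therefore recovered as 0.
\<close>
lemma half_elementary_gf_cong_0: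
  assumes k: "k = 0 \<and> n = half \<or> k = half \<and> n = p - 1" and i: "0 < i" "i < half"
  shows "elementary_gf k n $ i \<approx> 0"
proof -
  have n: "n < p" "n - k = half" using k p_eq by auto
  have zero: "poly (elementary_poly k n) (of_nat m ^ 2) \<approx> 0" if m: "m \<in> {1..half}" for m
  proof (cases "k = 0")
    case True
    show ?thesis
      by (rule elementary_poly_vanishes_mod_p[of _ _ m]) (use True k m n p_eq in auto)
  next
    case False
    have m': "0 < m" "m < p" using m p_eq by auto
    have "of_nat m ^ 2 * (1 / of_nat (p - m) ^ 2) \<approx> of_nat m ^ 2 * (1 / of_nat m ^ 2)"
      by (intro cong_p_mult_left inverse_square_reflect m') simp
    then have "1 - of_nat m ^ 2 / of_nat (p - m) ^ 2 \<approx> 1 - 1" using m'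
      by (intro cong_p_diff) auto
    then show ?thesis
      by (intro elementary_poly_vanishes_mod_p[of _ _ "p - m"]) (use False k m n p_eq in auto)
  qed
  have "elementary_gf k n $ i = coeff (elementary_poly k n) i" by (simp add: coeff_elementary_poly)
  also have "\<dots> \<approx> - 2 * (\<Sum>m\<in>{1..half}. poly (elementary_poly k n) (of_nat m ^ 2) * of_nat m ^ (2 * (half - i)))"
  proof (rule coefficient_extraction)
    show "coeff (elementary_poly k n) j = 0" if "j \<ge> half" "j \<noteq> half \<or> i = 0" for j
      using that i degree_elementary_poly[of k n] n by (intro coeff_eq_0) auto
    show "integral (coeff (elementary_poly k n) j)" for j
      using integral_elementary_gf[OF n(1), of k] by (simp add: coeff_elementary_poly integral_fps_def)
  qed (use i in auto)
  also have "\<dots> \<approx> - 2 * (\<Sum>m\<in>{1..half}. 0)"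
  proof (intro cong_p_mult_left cong_p_sum)
    fix m assume "m \<in> {1..half}"
    from cong_p_mult_left[OF zero[OF this], of "of_nat m ^ (2 * (half - i))"]
    show "poly (elementary_poly k n) (of_nat m ^ 2) * of_nat m ^ (2 * (half - i)) \<approx> 0"
      by (simp add: mult.commute)
  qed simp
  finally show ?thesis by simp
qed

lemma elementary_gf_full_cong_1:
  assumes "i < half"
  shows "elementary_gf 0 (p - 1) $ i \<approx> (1 :: rat fps) $ i"
proof (cases "i = 0")
  case False
  have p: "half < p" "p - 1 < p" "half \<le> p - 1" using p_eq by auto
  have "elementary_gf 0 (p - 1) $ i = (\<Sum>j=0..i. elementary_gf 0 half $ j * elementary_gf half (p - 1) $ (i - j))"
    using elementary_gf_split[of 0 half "p - 1"] p by (metis fps_mult_nth le0)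
  also have "\<dots> \<approx> (\<Sum>j=0..i. 0)"
  proof (rule cong_p_sum)
    fix j assume j: "j \<in> {0..i}"
    show "elementary_gf 0 half $ j * elementary_gf half (p - 1) $ (i - j) \<approx> 0"
    proof (cases "j = 0")
      case True
      then show ?thesis using half_elementary_gf_cong_0[of half "p - 1" i] False assms by simp
    next
      case False
      then have "elementary_gf half (p - 1) $ (i - j) * elementary_gf 0 half $ j \<approx> elementary_gf half (p - 1) $ (i - j) * 0"
        using integral_elementary_gf[OF p(2), of half] assms j
        by (intro cong_p_mult_left half_elementary_gf_cong_0) (auto simp: integral_fps_def)
      then show ?thesis by (simp add: mult.commute)
    qed
  qed
  finally show ?thesis using False by simp
qed simp

lemma elementary_gf_full_mult_cong:
  assumes "i < half" "integral_fps f"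
  shows "(elementary_gf 0 (p - 1) * f) $ i \<approx> f $ i"
proof -
  have "(elementary_gf 0 (p - 1) * f) $ i \<approx> (1 * f) $ i"
    unfolding fps_mult_nth using assms
    by (intro cong_p_sum cong_p_mult elementary_gf_full_cong_1) (auto simp: integral_fps_def fps_one_nth)
  then show ?thesis by simp
qed

text \<open>
  As the full product is 1 in low degrees, one of its parts is the inverse of the complementary part.
\<close>
lemma elementary_gf_cong_complete_gf:
  assumes "k < p" "i < half"
  shows "elementary_gf k (p - 1) $ i \<approx> complete_gf 0 k $ i"
    and "elementary_gf 0 k $ i \<approx> complete_gf k (p - 1) $ i"
proof -
  have split: "elementary_gf 0 (p - 1) = elementary_gf 0 k * elementary_gf k (p - 1)"
    using elementary_gf_split[of 0 k "p - 1"] assms by simp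
  have "elementary_gf k (p - 1) = elementary_gf 0 (p - 1) * complete_gf 0 k"
    using elementary_gf_mult_complete_gf[of 0 k] unfolding split by (simp add: ac_simps)
  then show "elementary_gf k (p - 1) $ i \<approx> complete_gf 0 k $ i"
    using elementary_gf_full_mult_cong[OF assms(2) integral_complete_gf[OF assms(1)], of 0] by simp
  have "elementary_gf 0 k = elementary_gf 0 (p - 1) * complete_gf k (p - 1)"
    using elementary_gf_mult_complete_gf[of k "p - 1"] unfolding split by (simp add: ac_simps)
  then show "elementary_gf 0 k $ i \<approx> complete_gf k (p - 1) $ i"
    using elementary_gf_full_mult_cong[OF assms(2) integral_complete_gf[of "p - 1"], of k] assms by simp
qed

lemma integral_nth:
  assumes "k < p"
  shows "integral (elementary_gf 0 k $ i)" "integral (complete_gf 0 k $ i)" "integral (elementary_gf k (p - 1) $ i)"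
  using integral_elementary_gf[of k 0] integral_complete_gf[of k 0] integral_elementary_gf[of "p - 1" k] assms
  by (auto simp: integral_fps_def)

lemma multiple_harmonic_sum_cong_mixed_sum:
  assumes "b < half"
  shows "multiple_harmonic_sum (replicate a 2 @ [1] @ replicate b 2) (p - 1) \<approx> (- 1) ^ (a + b) * mixed_sum (p - 1) a b"
proof -
  have "(- 1) ^ (a + b) * (\<Sum>k\<in>{1..p-1}. 1 / of_nat k * (elementary_gf 0 (k - 1) $ a * elementary_gf k (p - 1) $ b))
     \<approx> (- 1) ^ (a + b) * mixed_sum (p - 1) a b"
    unfolding mixed_sum_def
  proof (intro cong_p_mult_left cong_p_sum)
    fix k assume "k \<in> {1..p-1}"
    then have k: "0 < k" "k < p" by auto
    show "elementary_gf k (p - 1) $ b \<approx> complete_gf 0 k $ b"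
      by (rule elementary_gf_cong_complete_gf[OF k(2) assms])
    show "integral (1 / of_nat k)" using integral_bounded_frac[OF k, of 1] by simp
    show "integral (elementary_gf 0 (k - 1) $ a)" using k by (intro integral_nth) auto
  qed (intro integral_power integral_uminus integral_1)
  then show ?thesis
    unfolding multiple_harmonic_sum_twos_one_twos by simp
qed

lemma multiple_harmonic_star_sum_cong_mixed_sum:
  assumes "b < half"
  shows "multiple_harmonic_star_sum (replicate a 2 @ [1] @ replicate b 2) (p - 1) \<approx> mixed_sum (p - 1) b a"
proof -
  have "(\<Sum>k\<in>{1..p-1}. 1 / of_nat k * (complete_gf 0 k $ a * complete_gf (k - 1) (p - 1) $ b))
     \<approx> (\<Sum>k\<in>{1..p-1}. 1 / of_nat k * (complete_gf 0 k $ a * elementary_gf 0 (k - 1) $ b))"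
  proof (intro cong_p_mult_left cong_p_sum)
    fix k assume "k \<in> {1..p-1}"
    then have k: "0 < k" "k < p" by auto
    show "complete_gf (k - 1) (p - 1) $ b \<approx> elementary_gf 0 (k - 1) $ b"
      using k assms by (intro cong_p_sym[OF elementary_gf_cong_complete_gf(2)]) auto
    show "integral (1 / of_nat k)" using integral_bounded_frac[OF k, of 1] by simp
    show "integral (complete_gf 0 k $ a)" using k by (intro integral_nth) auto
  qed
  then show ?thesis
    unfolding multiple_harmonic_star_sum_twos_one_twos mixed_sum_def by (simp add: mult.commute)
qed

text \<open>
  Under k \<mapsto> p - k the factor 1/k changes sign, and the two coefficients are exchanged: reflection turns
  the product over j < p - k into the one over k < j < p, which is the inverse of the product over j \<le> k.
\<close>
lemma mixed_sum_reflect: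
  assumes "a < half" "b < half"
  shows "mixed_sum (p - 1) a b \<approx> mixed_sum half a b - mixed_sum half b a"
proof -
  let ?f = "\<lambda>a b k. 1 / of_nat k * (elementary_gf 0 (k - 1) $ a * complete_gf 0 k $ b) :: rat"
  have "(\<Sum>k\<in>{1..half}. ?f a b k + ?f a b (p - k)) \<approx> (\<Sum>k\<in>{1..half}. ?f a b k + - ?f b a k)"
  proof (intro cong_p_sum cong_p_add cong_p_refl)
    fix k assume "k \<in> {1..half}"
    then have k: "0 < k" "k < p" "p - k - 1 < p" "p - k < p" "k - 1 < p" using p_eq by auto
    have "elementary_gf 0 (p - 1 - k) $ a \<approx> complete_gf 0 k $ a"
      using elementary_gf_reflect[OF k(2)] elementary_gf_cong_complete_gf(1)[OF k(2) assms(1)] by (rule cong_p_trans)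
    moreover have "p - 1 - k = p - k - 1" by simp
    ultimately have 1: "elementary_gf 0 (p - k - 1) $ a \<approx> complete_gf 0 k $ a" by simp
    have "p - 1 - (p - k) = k - 1" using k by simp
    then have 2: "complete_gf 0 (p - k) $ b \<approx> elementary_gf 0 (k - 1) $ b"
      using elementary_gf_reflect[OF k(4), of b] elementary_gf_cong_complete_gf(1)[OF k(4) assms(2)]
      by (metis cong_p_sym cong_p_trans)
    have "?f a b (p - k) \<approx> - (1 / of_nat k) * (complete_gf 0 k $ a * elementary_gf 0 (k - 1) $ b)"
      by (intro cong_p_mult 1 2 inverse_reflect k integral_mult integral_nth integral_uminus)
         (use integral_bounded_frac[OF k(1,2), of 1] in simp)
    then show "?f a b (p - k) \<approx> - ?f b a k" by (simp add: mult.commute)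
  qed
  then show ?thesis
    unfolding mixed_sum_def sum_reflect_halves by (simp only: sum.distrib sum_negf) simp
qed

end

section \<open>Partial fractions and the kernel polynomials\<close>

text \<open>
  The coefficient of 1 / (1 - t/j^2) in the partial fraction decomposition of
  1 / ((1 - t/1^2) (1 - t/2^2) ... (1 - t/k^2)).
\<close>
definition partial_fraction_coeff :: "nat \<Rightarrow> nat \<Rightarrow> rat" where
  "partial_fraction_coeff k j = 2 * (- 1) ^ (j + 1) * fact k ^ 2 / (fact (k - j) * fact (k + j))"

text \<open>
  The partial sums telescope.  At m = k the correction term vanishes, and the total is 1, the value at
  t = 0 of the function being decomposed.
\<close>
lemma sum_partial_fraction_coeff_initial:
  assumes "0 < k" "m \<le> k"
  shows "(\<Sum>j\<in>{1..m}. partial_fraction_coeff k j)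
     = 1 - (- 1) ^ m * (of_nat k - of_nat m) * fact k ^ 2 / (of_nat k * fact (k - m) * fact (k + m))"
  using assms(2)
proof (induction m)
  case 0
  then show ?case using assms(1) by (simp add: power2_eq_square)
next
  case (Suc m)
  then obtain d where k: "k = Suc m + d" using le_Suc_ex by blast
  have IH: "(\<Sum>j\<in>{1..m}. partial_fraction_coeff k j)
     = 1 - (- 1) ^ m * (of_nat k - of_nat m) * fact k ^ 2 / (of_nat k * fact (k - m) * fact (k + m))"
    using Suc by simp
  define F G H K M S where "F = (fact d :: rat)" and "G = (fact (k + m) :: rat)" and "H = (fact k :: rat)"
    and "K = (of_nat k :: rat)" and "M = (of_nat m :: rat)" and "S = (of_nat (k + Suc m) :: rat)"
  have f: "fact (k - m) = (K - M) * F" "fact (k - Suc m) = F" "fact (k + Suc m) = S * G"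
    by (simp_all add: k F_def G_def K_def M_def S_def)
  have nz: "F \<noteq> 0" "G \<noteq> 0" "K \<noteq> 0" "S \<noteq> 0" "K - M \<noteq> 0"
    using assms(1) Suc.prems by (simp_all add: F_def G_def K_def M_def S_def del: of_nat_add)
  have M: "M = S - K - 1" by (simp add: S_def K_def M_def)
  have "(\<Sum>j\<in>{1..Suc m}. partial_fraction_coeff k j)
     = 1 - (- 1) ^ m * H ^ 2 / (K * F * G) + 2 * (- 1) ^ m * H ^ 2 / (F * (S * G))"
  proof -
    have "partial_fraction_coeff k (Suc m) = 2 * (- 1) ^ m * H ^ 2 / (F * (S * G))"
      unfolding partial_fraction_coeff_def f H_def by simp
    moreover have "(\<Sum>j\<in>{1..m}. partial_fraction_coeff k j) = 1 - (- 1) ^ m * H ^ 2 / (K * F * G)"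
      unfolding IH f G_def[symmetric] H_def[symmetric] K_def[symmetric] M_def[symmetric]
      using nz by simp
    ultimately show ?thesis by simp
  qed
  also have "\<dots> = 1 - (- 1) ^ Suc m * (K - (M + 1)) * H ^ 2 / (K * F * (S * G))"
    using nz(1-4) unfolding M by (simp add: field_simps)
  also have "M + 1 = of_nat (Suc m)" by (simp add: M_def)
  finally show ?case unfolding f K_def[symmetric] H_def[symmetric] by (simp only: mult.assoc)
qed

lemma sum_partial_fraction_coeff: "(\<Sum>j\<in>{1..k}. partial_fraction_coeff k j) = 1" if "0 < k"
  using sum_partial_fraction_coeff_initial[OF that order_refl] by simp

lemma partial_fraction_coeff_Suc:
  assumes "1 \<le> j" "j \<le> k"
  shows "partial_fraction_coeff k j / of_nat j ^ 2 + partial_fraction_coeff (Suc k) j / of_nat (Suc k) ^ 2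
    = partial_fraction_coeff (Suc k) j / of_nat j ^ 2"
proof -
  obtain d where k: "k = j + d" using assms le_Suc_ex by blast
  define F G H J K S T where "F = (fact d :: rat)" and "G = (fact (k + j) :: rat)" and "H = (fact k :: rat)"
    and "J = (of_nat j :: rat)" and "K = (of_nat (Suc k) :: rat)"
    and "S = (of_nat (Suc k + j) :: rat)" and "T = (of_nat (Suc d) :: rat)"
  have nz: "F \<noteq> 0" "G \<noteq> 0" "H \<noteq> 0" "J \<noteq> 0" "K \<noteq> 0" "S \<noteq> 0" "T \<noteq> 0"
    using assms(1) by (simp_all add: F_def G_def H_def J_def K_def S_def T_def del: of_nat_add of_nat_Suc)
  have f: "fact (Suc k - j) = T * F" "fact (k - j) = F" "fact k = H"
    "fact (k + j) = G" "fact (Suc k + j) = S * G" "fact (Suc k) = K * H"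
    by (simp_all add: k F_def G_def H_def K_def S_def T_def Suc_diff_le)
  have ST: "S = K + J" "T = K - J" by (simp_all add: S_def T_def K_def J_def k)
  have "2 * (- 1) ^ (j + 1) * H ^ 2 / (F * G) / J ^ 2 + 2 * (- 1) ^ (j + 1) * (K * H) ^ 2 / (T * F * (S * G)) / K ^ 2
     = 2 * (- 1) ^ (j + 1) * H ^ 2 * (T * S + J ^ 2) / (F * G * T * S * J ^ 2)"
    using nz by (simp add: field_simps power2_eq_square)
  also have "T * S + J ^ 2 = K ^ 2" unfolding ST by (simp add: algebra_simps power2_eq_square)
  also have "2 * (- 1) ^ (j + 1) * H ^ 2 * K ^ 2 / (F * G * T * S * J ^ 2)
     = 2 * (- 1) ^ (j + 1) * (K * H) ^ 2 / (T * F * (S * G)) / J ^ 2"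
    by (simp add: power_mult_distrib ac_simps)
  finally show ?thesis
    unfolding partial_fraction_coeff_def f J_def[symmetric] K_def[symmetric] .
qed

text \<open>
  Removing the factor for k + 1 from the product multiplies the coefficient belonging to j by
  1 - j^2/(k + 1)^2; this is the content of the preceding lemma and makes the induction work.  For
  k = b = 0 the left side is 1 but the right side is an empty sum.
\<close>
lemma complete_gf_partial_fractions:
  "0 < k \<or> 0 < b \<Longrightarrow> complete_gf 0 k $ b = (\<Sum>j\<in>{1..k}. partial_fraction_coeff k j * (1 / of_nat j ^ 2) ^ b)"
proof (induction b arbitrary: k)
  case 0
  then show ?case using sum_partial_fraction_coeff[of k] by simp
next
  case (Suc b)
  note IH = Suc.IH
  show ?case
  proof (induction k)
    case (Suc k)
    let ?x = "\<lambda>j. 1 / of_nat j ^ 2 :: rat"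
    have "complete_gf 0 (Suc k) $ Suc b = (\<Sum>j\<in>{1..k}. partial_fraction_coeff k j * ?x j ^ Suc b)
       + (\<Sum>j\<in>{1..Suc k}. partial_fraction_coeff (Suc k) j * ?x j ^ b) / of_nat (Suc k) ^ 2"
      using complete_gf_nth_Suc[of 0 k b] Suc IH[of "Suc k"] by simp
    also have "\<dots> = (\<Sum>j\<in>{1..k}. (partial_fraction_coeff k j * ?x j + partial_fraction_coeff (Suc k) j / of_nat (Suc k) ^ 2) * ?x j ^ b)
       + partial_fraction_coeff (Suc k) (Suc k) * ?x (Suc k) ^ Suc b"
      by (simp add: sum_divide_distrib sum.distrib add_divide_distrib algebra_simps)
    also have "(\<Sum>j\<in>{1..k}. (partial_fraction_coeff k j * ?x j + partial_fraction_coeff (Suc k) j / of_nat (Suc k) ^ 2) * ?x j ^ b)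
       = (\<Sum>j\<in>{1..k}. partial_fraction_coeff (Suc k) j * ?x j ^ Suc b)"
    proof (rule sum.cong)
      fix j assume "j \<in> {1..k}"
      then have "partial_fraction_coeff k j * ?x j + partial_fraction_coeff (Suc k) j / of_nat (Suc k) ^ 2
          = partial_fraction_coeff (Suc k) j * ?x j"
        using partial_fraction_coeff_Suc[of j k] by simp
      then show "(partial_fraction_coeff k j * ?x j + partial_fraction_coeff (Suc k) j / of_nat (Suc k) ^ 2) * ?x j ^ b
         = partial_fraction_coeff (Suc k) j * ?x j ^ Suc b"
        by (simp only: power_Suc mult.assoc)
    qed simp
    finally show ?case by simp
  qed simp
qed

lemma alternating_binomial_sum_Suc:
  "(\<Sum>l\<le>Suc d. (- 1) ^ l * of_nat (Suc d choose l) * f l)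
    = (\<Sum>l\<le>d. (- 1) ^ l * of_nat (d choose l) * (f l - f (Suc l)) :: rat)"
proof -
  have "(\<Sum>l\<le>Suc d. (- 1) ^ l * of_nat (Suc d choose l) * f l)
     = f 0 + (\<Sum>l\<le>d. (- 1) ^ Suc l * of_nat (Suc d choose Suc l) * f (Suc l))"
    unfolding sum.atMost_Suc_shift by simp
  also have "(\<Sum>l\<le>d. (- 1) ^ Suc l * of_nat (Suc d choose Suc l) * f (Suc l))
     = (\<Sum>l\<le>d. (- 1) ^ Suc l * of_nat (d choose l) * f (Suc l)) + (\<Sum>l\<le>d. (- 1) ^ Suc l * of_nat (d choose Suc l) * f (Suc l))"
    unfolding sum.distrib[symmetric] by (rule sum.cong) (simp_all add: algebra_simps)
  also have "f 0 + (\<dots>) = (\<Sum>l\<le>d. (- 1) ^ Suc l * of_nat (d choose l) * f (Suc l)) + (\<Sum>l\<le>Suc d. (- 1) ^ l * of_nat (d choose l) * f l)"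
    unfolding sum.atMost_Suc_shift by simp
  also have "(\<Sum>l\<le>Suc d. (- 1) ^ l * of_nat (d choose l) * f l) = (\<Sum>l\<le>d. (- 1) ^ l * of_nat (d choose l) * f l)"
    by simp
  finally show ?thesis
    by (simp add: sum.distrib[symmetric] algebra_simps sum_subtractf sum_negf)
qed

text \<open>
  The d-th difference of a binomial coefficient, which vanishes when d exceeds the degree r.
\<close>
lemma alternating_binomial_convolution:
  "(\<Sum>l\<le>d. (- 1) ^ l * of_nat (d choose l) * of_nat ((N + l) choose r))
     = (- 1) ^ d * (if r < d then 0 else of_nat (N choose (r - d)) :: rat)"
proof (induction d arbitrary: r)
  case (Suc d)
  show ?case
  proof (cases r)
    case 0
    then show ?thesis unfolding alternating_binomial_sum_Suc by simp
  next
    case r: (Suc r')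
    have "(\<Sum>l\<le>Suc d. (- 1) ^ l * of_nat (Suc d choose l) * of_nat ((N + l) choose r))
       = - (\<Sum>l\<le>d. (- 1) ^ l * of_nat (d choose l) * of_nat ((N + l) choose r') :: rat)"
      unfolding alternating_binomial_sum_Suc r by (simp add: sum_negf)
    then show ?thesis using Suc.IH[of r'] r by simp
  qed
qed simp

text \<open>
  Write d = m - j and split the factor k as (k + j) - j.  The first part is a d-th difference of a
  polynomial of degree d and contributes the constant value; the second is a d-th difference of a
  polynomial of degree d - 1 and vanishes.  For d = 0 there is only one term.
\<close>
lemma factorial_kernel_sum:
  assumes "0 < j" "j \<le> m"
  shows "(\<Sum>k\<in>{j..m}. (- 1) ^ k * of_nat k * fact (m + k - 1) / (fact (m - k) * fact (k - j) * fact (k + j)))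
     = (- 1) ^ m * (if j = m then 1 / 2 else 1 :: rat)"
proof (cases "j = m")
  case True
  have "fact (m + m) = of_nat (m + m) * (fact (m + m - 1) :: rat)"
    by (rule fact_reduce) (use assms True in auto)
  then show ?thesis using True assms by (simp add: divide_simps)
next
  case False
  define d where "d = m - j"
  have d: "m = j + d" "0 < d" using False assms by (auto simp: d_def)
  let ?N = "m + j - 1"
  have "(\<Sum>k\<in>{j..m}. (- 1) ^ k * of_nat k * fact (m + k - 1) / (fact (m - k) * fact (k - j) * fact (k + j)))
     = (\<Sum>l\<le>d. (- 1) ^ (j + l) * of_nat (j + l) * fact (?N + l) / (fact (d - l) * fact l * fact (2 * j + l)) :: rat)"
    by (rule sum.reindex_bij_witness[of _ "\<lambda>l. j + l" "\<lambda>k. k - j"]) (use d assms in \<open>auto simp: algebra_simps\<close>)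
  also have "\<dots> = (\<Sum>l\<le>d. (- 1) ^ j * ((- 1) ^ l * of_nat (d choose l) * of_nat ((?N + l) choose d))
      - (- 1) ^ j * (of_nat j / of_nat d) * ((- 1) ^ l * of_nat (d choose l) * of_nat ((?N + l) choose (d - 1))))"
  proof (rule sum.cong)
    fix l assume "l \<in> {..d}"
    then have l: "l \<le> d" by simp
    have 1: "of_nat (d choose l) = (fact d / (fact l * fact (d - l)) :: rat)"
      using l by (rule binomial_fact)
    have "?N + l - d = 2 * j + l - 1" "d \<le> ?N + l" using d assms by auto
    then have 2: "of_nat ((?N + l) choose d) = (fact (?N + l) / (fact d * fact (2 * j + l - 1)) :: rat)"
      using binomial_fact[of d "?N + l"] by simp
    have "?N + l - (d - 1) = 2 * j + l" "d - 1 \<le> ?N + l" using d assms by auto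
    then have 3: "of_nat ((?N + l) choose (d - 1)) = (fact (?N + l) / (fact (d - 1) * fact (2 * j + l)) :: rat)"
      using binomial_fact[of "d - 1" "?N + l"] by simp
    have 4: "fact (2 * j + l) = (of_nat (2 * j + l) * fact (2 * j + l - 1) :: rat)"
      by (rule fact_reduce) (use assms in auto)
    have 5: "fact d = (of_nat d * fact (d - 1) :: rat)"
      by (rule fact_reduce) (use d in auto)
    define A B C D E where "A = (fact (2 * j + l - 1) :: rat)" and "B = (fact (d - 1) :: rat)"
      and "C = (fact l :: rat)" and "D = (fact (d - l) :: rat)" and "E = (fact (?N + l) :: rat)"
    define S where "S = (of_nat (2 * j + l) :: rat)"
    have nz: "A \<noteq> 0" "B \<noteq> 0" "C \<noteq> 0" "D \<noteq> 0" "(of_nat d :: rat) \<noteq> 0" "S \<noteq> 0"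
      using d assms by (simp_all add: A_def B_def C_def D_def S_def del: of_nat_add of_nat_mult)
    have jl: "of_nat (j + l) = S - of_nat j" by (simp add: S_def)
    show "(- 1) ^ (j + l) * of_nat (j + l) * fact (?N + l) / (fact (d - l) * fact l * fact (2 * j + l))
       = (- 1) ^ j * ((- 1) ^ l * of_nat (d choose l) * of_nat ((?N + l) choose d))
      - (- 1) ^ j * (of_nat j / of_nat d) * ((- 1) ^ l * of_nat (d choose l) * of_nat ((?N + l) choose (d - 1)) :: rat)"
      unfolding 1 2 3 4 5 A_def[symmetric] B_def[symmetric] C_def[symmetric] D_def[symmetric] E_def[symmetric] S_def[symmetric] power_add jl
      using nz by (simp add: field_simps)
  qed simp
  also have "\<dots> = (- 1) ^ j * (- 1) ^ d"
    using d unfolding sum_subtractf sum_distrib_left[symmetric] alternating_binomial_convolution by simp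
  finally show ?thesis using False by (simp add: d(1) power_add)
qed

lemma prod_one_minus_square_quotient:
  assumes "0 < k" "0 < m"
  shows "(\<Prod>i\<in>{0<..k-1}. 1 - of_nat m ^ 2 / of_nat i ^ 2)
     = (if k \<le> m then - ((- 1) ^ k) * fact (m + k - 1) / (of_nat m * fact (m - k) * fact (k - 1) ^ 2) else 0 :: rat)"
proof (cases "k \<le> m")
  case False
  then have "m \<in> {0<..k-1}" using assms by auto
  then show ?thesis using False assms by (simp add: prod_zero_iff)
next
  case True
  from assms(1) True show ?thesis
  proof (induction k rule: nat_induct_non_zero)
    case 1
    then show ?case using assms(2) by (simp add: fact_reduce[of m])
  next
    case (Suc k)
    have k: "{0<..Suc k - 1} = insert k {0<..k-1}" "k \<notin> {0<..k-1}" using Suc.hyps by auto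
    obtain d where d: "m = Suc k + d" using Suc.prems le_Suc_ex by blast
    have IH: "(\<Prod>i\<in>{0<..k-1}. 1 - of_nat m ^ 2 / of_nat i ^ 2)
       = - ((- 1) ^ k) * fact (m + k - 1) / (of_nat m * fact (m - k) * fact (k - 1) ^ 2 :: rat)"
      using Suc by simp
    define T A B C where "T = (of_nat (Suc d) :: rat)" and "A = (fact (m + k - 1) :: rat)" and "B = (fact d :: rat)" and "C = (fact (k - 1) :: rat)"
    have f: "fact (m + Suc k - 1) = (of_nat m + of_nat k) * A" "fact (m - k) = T * B"
       "fact (m - Suc k) = B" "fact (Suc k - 1) = of_nat k * C"
      using Suc.hyps assms by (simp_all add: A_def B_def C_def T_def d fact_reduce[of "m + k"] fact_reduce[of k])
    have nz: "B \<noteq> 0" "C \<noteq> 0" "(of_nat m :: rat) \<noteq> 0" "(of_nat k :: rat) \<noteq> 0" "T \<noteq> 0"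
      using Suc.hyps assms by (simp_all add: B_def C_def T_def del: of_nat_Suc)
    have md: "T = of_nat m - of_nat k" by (simp add: d T_def)
    have "(\<Prod>i\<in>{0<..Suc k - 1}. 1 - of_nat m ^ 2 / of_nat i ^ 2)
       = (1 - of_nat m ^ 2 / of_nat k ^ 2) * (- ((- 1) ^ k) * A / (of_nat m * (T * B) * C ^ 2))"
      unfolding k(1) prod.insert[OF finite_greaterThanAtMost k(2)] IH f A_def[symmetric] C_def[symmetric] ..
    also have "1 - of_nat m ^ 2 / of_nat k ^ 2 = - (T * (of_nat m + of_nat k) / of_nat k ^ 2)"
      using nz unfolding md by (simp add: field_simps power2_eq_square)
    also have "\<dots> * (- ((- 1) ^ k) * A / (of_nat m * (T * B) * C ^ 2))
       = - ((- 1) ^ Suc k) * ((of_nat m + of_nat k) * A) / (of_nat m * B * (of_nat k * C) ^ 2)"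
      using nz by (simp add: field_simps)
    finally show ?case unfolding f using Suc.prems by simp
  qed
qed

text \<open>
  The polynomial that collects, after the partial fraction decomposition of the second factor of
  mixed_sum, everything belonging to the pole j^2.
\<close>
definition kernel_poly :: "nat \<Rightarrow> nat \<Rightarrow> rat poly" where
  "kernel_poly n j = (\<Sum>k\<in>{j..n}. smult (fact k ^ 2 / (of_nat k * fact (k - j) * fact (k + j))) (elementary_poly 0 (k - 1)))"

lemma poly_kernel_poly:
  assumes "0 < j" "0 < m" "m \<le> n"
  shows "poly (kernel_poly n j) (of_nat m ^ 2)
    = - ((- 1) ^ m) / of_nat m * (if j < m then 1 else if j = m then 1 / 2 else 0)"
proof -
  have "poly (kernel_poly n j) (of_nat m ^ 2)
     = (\<Sum>k\<in>{j..n}. if k \<le> m then - (1 / of_nat m) * ((- 1) ^ k * of_nat k * fact (m + k - 1) / (fact (m - k) * fact (k - j) * fact (k + j))) else 0)"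
    unfolding kernel_poly_def poly_sum poly_smult poly_elementary_poly
  proof (rule sum.cong)
    fix k assume "k \<in> {j..n}"
    then have k: "0 < k" using assms by simp
    have f: "fact k = (of_nat k * fact (k - 1) :: rat)" by (rule fact_reduce[OF k])
    show "fact k ^ 2 / (of_nat k * fact (k - j) * fact (k + j)) * (\<Prod>i\<in>{0<..k-1}. 1 - of_nat m ^ 2 / of_nat i ^ 2)
       = (if k \<le> m then - (1 / of_nat m) * ((- 1) ^ k * of_nat k * fact (m + k - 1) / (fact (m - k) * fact (k - j) * fact (k + j))) else 0 :: rat)"
      unfolding prod_one_minus_square_quotient[OF k assms(2)] f using k assms
      by (simp add: field_simps power2_eq_square)
  qed simp
  also have "\<dots> = (\<Sum>k\<in>{j..m}. - (1 / of_nat m) * ((- 1) ^ k * of_nat k * fact (m + k - 1) / (fact (m - k) * fact (k - j) * fact (k + j))))"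
    using assms by (intro sum.mono_neutral_cong_right) auto
  also have "\<dots> = - (1 / of_nat m) * (\<Sum>k\<in>{j..m}. (- 1) ^ k * of_nat k * fact (m + k - 1) / (fact (m - k) * fact (k - j) * fact (k + j)))"
    by (rule sum_distrib_left[symmetric])
  also have "\<dots> = - ((- 1) ^ m) / of_nat m * (if j < m then 1 else if j = m then 1 / 2 else 0)"
    using factorial_kernel_sum[OF assms(1), of m] by (cases "j \<le> m") auto
  finally show ?thesis .
qed

lemma mixed_sum_kernel_poly:
  "mixed_sum n a b = (\<Sum>j\<in>{1..n}. 2 * (- 1) ^ (j + 1) * (1 / of_nat j ^ 2) ^ b * coeff (kernel_poly n j) a)"
proof -
  let ?t = "\<lambda>k j. 1 / of_nat k * (elementary_gf 0 (k - 1) $ a * (partial_fraction_coeff k j * (1 / of_nat j ^ 2) ^ b)) :: rat"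
  have "mixed_sum n a b = (\<Sum>k\<in>{1..n}. \<Sum>j\<in>{j\<in>{1..n}. j \<le> k}. ?t k j)"
    unfolding mixed_sum_def
  proof (rule sum.cong)
    fix k assume k: "k \<in> {1..n}"
    then have "{1..k} = {j\<in>{1..n}. j \<le> k}" by auto
    then show "1 / of_nat k * (elementary_gf 0 (k - 1) $ a * complete_gf 0 k $ b) = (\<Sum>j\<in>{j\<in>{1..n}. j \<le> k}. ?t k j)"
      using k by (simp add: complete_gf_partial_fractions sum_distrib_left sum_divide_distrib)
  qed simp
  also have "\<dots> = (\<Sum>j\<in>{1..n}. \<Sum>k\<in>{k\<in>{1..n}. j \<le> k}. ?t k j)"
    by (rule sum.swap_restrict) auto
  also have "\<dots> = (\<Sum>j\<in>{1..n}. 2 * (- 1) ^ (j + 1) * (1 / of_nat j ^ 2) ^ b * coeff (kernel_poly n j) a)"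
  proof (rule sum.cong)
    fix j assume j: "j \<in> {1..n}"
    then have "{k\<in>{1..n}. j \<le> k} = {j..n}" by auto
    then show "(\<Sum>k\<in>{k\<in>{1..n}. j \<le> k}. ?t k j) = 2 * (- 1) ^ (j + 1) * (1 / of_nat j ^ 2) ^ b * coeff (kernel_poly n j) a"
      unfolding kernel_poly_def coeff_sum coeff_smult coeff_elementary_poly sum_distrib_left
      by (intro sum.cong) (auto simp: partial_fraction_coeff_def field_simps)
  qed simp
  finally show ?thesis .
qed

section \<open>Alternating power sums and the expansion of tanh\<close>

text \<open>
  The expansion of tanh(x/2), as (e^x - 1)/(e^x + 1).  Its odd coefficients are the values at 0 of the
  Euler polynomials up to sign.
\<close>
definition tanh_gf :: "rat fps" where
  "tanh_gf = (fps_exp 1 - 1) / (fps_exp 1 + 1)"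

definition tanh_number :: "nat \<Rightarrow> rat" where
  "tanh_number r = fact r * tanh_gf $ r"

lemma tanh_gf_mult: "tanh_gf * (fps_exp 1 + 1) = fps_exp 1 - 1"
proof -
  have "(fps_exp 1 + 1 :: rat fps) dvd fps_exp 1 - 1"
    by (rule fps_unit_dvd) simp
  from dvd_div_mult_self[OF this] show ?thesis unfolding tanh_gf_def .
qed

lemma fps_exp_plus_1_neq_0: "fps_exp 1 + 1 \<noteq> (0 :: rat fps)"
proof
  assume "fps_exp 1 + 1 = (0 :: rat fps)"
  from arg_cong[OF this, of "\<lambda>f. f $ 0"] show False by simp
qed

text \<open>
  tanh is odd: the substitution x \<mapsto> -x negates the generating function.
\<close>
lemma tanh_number_even:
  assumes "even r" shows "tanh_number r = 0"
proof -
  let ?m = "\<lambda>f :: rat fps. fps_compose f (fps_const (- 1) * fps_X)"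
  have e: "?m (fps_exp 1) * fps_exp 1 = 1"
    using fps_exp_compose_linear[of 1 "- 1 :: rat"] by (simp add: fps_exp_add_mult[symmetric])
  define T E where "T = ?m tanh_gf" and "E = ?m (fps_exp 1)"
  have "T * (E + 1) = E - 1" unfolding T_def E_def
    using arg_cong[OF tanh_gf_mult, of ?m]
    by (simp add: fps_compose_mult_distrib fps_compose_add_distrib fps_compose_sub_distrib)
  then have "T * (E + 1) * fps_exp 1 = (E - 1) * fps_exp 1" by simp
  then have "T * (E * fps_exp 1 + fps_exp 1) = E * fps_exp 1 - fps_exp 1"
    by (simp add: algebra_simps)
  then have "T * (fps_exp 1 + 1) = - (tanh_gf * (fps_exp 1 + 1))"
    using e unfolding E_def[symmetric] tanh_gf_mult by (simp add: add.commute)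
  then have "?m tanh_gf * (fps_exp 1 + 1) = - tanh_gf * (fps_exp 1 + 1)"
    unfolding T_def by simp
  then have "?m tanh_gf = - tanh_gf" by (rule iffD1[OF mult_right_cancel[OF fps_exp_plus_1_neq_0]])
  from arg_cong[OF this, of "\<lambda>f. f $ r"] show ?thesis
    using assms by (simp add: fps_compose_linear tanh_number_def)
qed

lemma tanh_number_recursion:
  assumes "0 < r"
  shows "2 * tanh_number r = 1 - (\<Sum>i<r. of_nat (r choose i) * tanh_number i)"
proof -
  have "(\<Sum>i\<le>r. tanh_gf $ i * (1 / fact (r - i))) + tanh_gf $ r = 1 / fact r"
    using arg_cong[OF tanh_gf_mult, of "\<lambda>f. f $ r"] assms
    by (simp add: fps_mult_nth distrib_left atLeast0AtMost)
  then have "fact r * ((\<Sum>i\<le>r. tanh_gf $ i * (1 / fact (r - i))) + tanh_gf $ r) = 1" by simp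
  moreover have "fact r * (\<Sum>i\<le>r. tanh_gf $ i * (1 / fact (r - i))) = (\<Sum>i\<le>r. of_nat (r choose i) * tanh_number i)"
    unfolding sum_distrib_left by (rule sum.cong) (auto simp: tanh_number_def binomial_fact)
  ultimately have "(\<Sum>i\<le>r. of_nat (r choose i) * tanh_number i) + tanh_number r = 1"
    by (simp add: distrib_left tanh_number_def)
  then show ?thesis unfolding lessThan_Suc_atMost[symmetric] by simp
qed

lemma bernoulli_recursion:
  "of_nat (Suc n) * bernoulli n = (if n = 0 then 1 else 0) - (\<Sum>i<n. of_nat (Suc n choose i) * bernoulli i)"
proof -
  have e1: "(\<Sum>i\<le>Suc n. bernoulli i / fact i * (fps_exp 1 - 1) $ (Suc n - i)) = (if n = 0 then 1 else 0)"
    using arg_cong[OF bernoulli_egf, of "\<lambda>f. f $ Suc n"] by (simp add: fps_mult_nth atLeast0AtMost)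
  have e2: "(\<Sum>i\<le>Suc n. bernoulli i / fact i * (fps_exp 1 - 1) $ (Suc n - i))
      = (\<Sum>i\<le>n. bernoulli i / fact i * (1 / fact (Suc n - i)))"
    by (auto intro!: sum.cong)
  have "fact (Suc n) * (\<Sum>i\<le>n. bernoulli i / fact i * (1 / fact (Suc n - i))) = (if n = 0 then 1 else 0)"
    unfolding e1[unfolded e2] by simp
  moreover have "fact (Suc n) * (\<Sum>i\<le>n. bernoulli i / fact i * (1 / fact (Suc n - i)))
     = (\<Sum>i\<le>n. of_nat (Suc n choose i) * bernoulli i)"
    unfolding sum_distrib_left
  proof (rule sum.cong)
    fix i assume "i \<in> {..n}"
    then have "of_nat (Suc n choose i) = (fact (Suc n) / (fact i * fact (Suc n - i)) :: rat)"
      by (intro binomial_fact) auto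
    then show "fact (Suc n) * (bernoulli i / fact i * (1 / fact (Suc n - i))) = of_nat (Suc n choose i) * bernoulli i"
      by (simp del: fact_Suc)
  qed simp
  ultimately have "(\<Sum>i\<le>n. of_nat (Suc n choose i) * bernoulli i) = (if n = 0 then 1 else 0)" by simp
  then show ?thesis unfolding lessThan_Suc_atMost[symmetric] by simp
qed

lemma fps_2_mult_nth: "(2 * f) $ n = 2 * (f $ n :: rat)"
  by (simp add: numeral_fps_const)

text \<open>
  With b(x) = x/(e^x - 1), the identity b(x) - b(2x) = x/(e^x + 1) holds, and 2/(e^x + 1) = 1 - tanh(x/2).
\<close>
lemma tanh_number_bernoulli:
  assumes "0 < r"
  shows "tanh_number r = 2 * (2 ^ Suc r - 1) * bernoulli (Suc r) / of_nat (Suc r)"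
proof -
  define b where "b = Abs_fps (\<lambda>k. bernoulli k / fact k)"
  let ?d = "\<lambda>f :: rat fps. fps_compose f (fps_const 2 * fps_X)"
  let ?e = "fps_exp 1 :: rat fps"
  have b: "b * (?e - 1) = fps_X" unfolding b_def by (rule bernoulli_egf)
  have e2: "?d ?e = ?e * ?e"
    by (simp add: fps_exp_add_mult[symmetric] fps_exp_compose_linear)
  have "?d b * (?e * ?e - 1) = fps_const 2 * fps_X"
    using arg_cong[OF b, of ?d] e2
    by (simp add: fps_compose_mult_distrib fps_compose_sub_distrib)
  moreover have "b * (?e * ?e - 1) = (b * (?e - 1)) * (?e + 1)" by (simp add: algebra_simps)
  ultimately have "(b - ?d b) * (?e * ?e - 1) = fps_X * (?e + 1) - fps_const 2 * fps_X"
    unfolding b by (simp add: left_diff_distrib)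
  also have "\<dots> = fps_X * (?e - 1)"
    by (simp add: algebra_simps numeral_fps_const[symmetric])
  also have "?e * ?e - 1 = (?e + 1) * (?e - 1)" by (simp add: algebra_simps)
  finally have eq: "((b - ?d b) * (?e + 1)) * (?e - 1) = fps_X * (?e - 1)" by (simp add: mult.assoc)
  have nz: "?e - 1 \<noteq> 0"
  proof
    assume "?e - 1 = 0"
    from arg_cong[OF this, of "\<lambda>f. f $ 1"] show False by simp
  qed
  have 1: "(b - ?d b) * (?e + 1) = fps_X" by (rule iffD1[OF mult_right_cancel[OF nz] eq])
  have 2: "(1 - tanh_gf) * (?e + 1) = 2" by (simp add: left_diff_distrib tanh_gf_mult)
  have "2 * (b - ?d b) * (?e + 1) = (fps_X * (1 - tanh_gf)) * (?e + 1)"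
    unfolding mult.assoc 1 2 by simp
  then have "2 * (b - ?d b) = fps_X * (1 - tanh_gf)"
    by (rule iffD1[OF mult_right_cancel[OF fps_exp_plus_1_neq_0]])
  from arg_cong[OF this, of "\<lambda>f. f $ Suc r"]
  have "2 * (b $ Suc r - ?d b $ Suc r) = (1 - tanh_gf) $ r"
    by (simp only: fps_2_mult_nth fps_sub_nth fps_X_mult_nth) simp
  moreover have "?d b $ Suc r = 2 ^ Suc r * b $ Suc r" by (subst fps_compose_linear) simp
  ultimately have "tanh_gf $ r = 2 * (2 ^ Suc r - 1) * b $ Suc r"
    using assms by (simp add: algebra_simps)
  then have "tanh_number r = fact r * (2 * (2 ^ Suc r - 1) * (bernoulli (Suc r) / fact (Suc r)))"
    unfolding tanh_number_def b_def by simp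
  moreover have "fact (Suc r) = (of_nat (Suc r) * fact r :: rat)" by (rule fact_Suc)
  ultimately show ?thesis by (simp del: of_nat_Suc fact_Suc)
qed

lemma alternating_exp_sum:
  "(\<Sum>j<m. fps_const ((- 1) ^ j) * fps_exp (of_nat j)) * (fps_exp 1 + 1)
     = 1 - fps_const ((- 1) ^ m) * fps_exp (of_nat m :: rat)"
proof (induction m)
  case (Suc m)
  have "fps_exp (of_nat (Suc m)) = fps_exp (of_nat m) * fps_exp (1 :: rat)"
    by (simp add: fps_exp_add_mult[symmetric] add.commute)
  then show ?case using Suc by (simp add: distrib_right distrib_left algebra_simps flip: fps_const_neg)
qed simp

text \<open>
  The exponential generating function of the alternating sum is a geometric sum.  Counting the last term
  half makes the result a multiple of tanh(x/2), up to the sign-dependent term (-1)^m (1 - tanh(x/2)),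
  which contributes nothing in even positive degree r.  What remains is a polynomial in m.
\<close>
lemma alternating_power_sum:
  assumes "even r" "0 < r"
  shows "2 * (\<Sum>j<m. (- 1) ^ (j + m) * of_nat j ^ r) + of_nat m ^ r
     = (\<Sum>i\<le>r. of_nat (r choose i) * tanh_number (r - i) * of_nat m ^ i)"
proof -
  let ?e = "fps_exp 1 :: rat fps"
  let ?E = "fps_exp (of_nat m) :: rat fps"
  let ?s = "fps_const ((- 1) ^ m) :: rat fps"
  define A where "A = (\<Sum>j<m. fps_const ((- 1) ^ j) * fps_exp (of_nat j :: rat))"
  have ss: "?s * ?s = 1" by (simp add: power_mult_distrib[symmetric] fps_const_mult[symmetric] flip: power_add)
  have A: "A * (?e + 1) = 1 - ?s * ?E" unfolding A_def by (rule alternating_exp_sum)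
  have "(2 * ?s * A + ?E) * (?e + 1) = 2 * ?s * (A * (?e + 1)) + ?E * (?e + 1)" by (simp add: algebra_simps)
  also have "\<dots> = 2 * ?s - 2 * (?s * ?s) * ?E + ?E * (?e + 1)" unfolding A by (simp add: algebra_simps)
  also have "\<dots> = 2 * ?s + ?E * (?e - 1)" unfolding ss by (simp add: algebra_simps)
  also have "\<dots> = ?s * (?e + 1 - (?e - 1)) + ?E * (?e - 1)" by (simp add: algebra_simps)
  also have "\<dots> = (tanh_gf * ?E + ?s * (1 - tanh_gf)) * (?e + 1)"
    unfolding tanh_gf_mult[symmetric] by (simp add: algebra_simps)
  finally have eq: "2 * ?s * A + ?E = tanh_gf * ?E + ?s * (1 - tanh_gf)"
    by (rule iffD1[OF mult_right_cancel[OF fps_exp_plus_1_neq_0]])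
  have tanh0: "tanh_gf $ r = 0" using tanh_number_even[OF assms(1)] by (simp add: tanh_number_def)
  have lhs: "fact r * (2 * ?s * A + ?E) $ r = 2 * (\<Sum>j<m. (- 1) ^ (j + m) * of_nat j ^ r) + of_nat m ^ r"
  proof -
    have "(2 * ?s * A) $ r = 2 * ((- 1) ^ m * A $ r)" by (simp add: mult.assoc fps_2_mult_nth)
    moreover have "A $ r = (\<Sum>j<m. (- 1) ^ j * of_nat j ^ r) / fact r"
      unfolding A_def by (simp add: fps_sum_nth sum_divide_distrib)
    moreover have "(- 1) ^ m * (\<Sum>j<m. (- 1) ^ j * of_nat j ^ r) = (\<Sum>j<m. (- 1) ^ (j + m) * of_nat j ^ r :: rat)"
      by (simp add: sum_distrib_left power_add mult_ac)
    ultimately show ?thesis by (simp add: field_simps)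
  qed
  have rhs: "fact r * (tanh_gf * ?E + ?s * (1 - tanh_gf)) $ r
     = (\<Sum>i\<le>r. of_nat (r choose i) * tanh_number (r - i) * of_nat m ^ i)"
  proof -
    have "fact r * (tanh_gf * ?E + ?s * (1 - tanh_gf)) $ r = (\<Sum>i\<le>r. fact r * (of_nat m ^ i / fact i * tanh_gf $ (r - i)))"
      using assms tanh0 by (subst mult.commute[of tanh_gf]) (simp add: fps_mult_nth[of ?E] atLeast0AtMost sum_distrib_left)
    also have "\<dots> = (\<Sum>i\<le>r. of_nat (r choose i) * tanh_number (r - i) * of_nat m ^ i)"
      by (rule sum.cong) (auto simp: tanh_number_def binomial_fact)
    finally show ?thesis .
  qed
  show ?thesis using eq lhs rhs by simp
qed

lemma sum_odd_indices:
  fixes f :: "nat \<Rightarrow> rat"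
  assumes "\<And>i. even i \<Longrightarrow> f i = 0"
  shows "(\<Sum>i\<le>2 * B. f i) = (\<Sum>c<B. f (2 * c + 1))"
  by (induction B) (simp_all add: assms)

text \<open>
  The rational factor of the theorem is 1/(2b + 1) - 1/(2a + 1), and either fraction can be absorbed into
  the binomial coefficient.
\<close>
lemma choose_odd_difference:
  "(of_nat (2 * a + 2 * b + 1 choose (2 * b + 1)) - of_nat (2 * a + 2 * b + 1 choose (2 * a + 1))) / of_nat (2 * (a + b) + 1)
     = 2 * (of_nat a - of_nat b) / ((2 * of_nat a + 1) * (2 * of_nat b + 1)) * (of_nat (2 * a + 2 * b choose (2 * a)) :: rat)"
proof -
  define X Y c n s t where "X = (of_nat (2 * a + 2 * b + 1 choose (2 * b + 1)) :: rat)"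
    and "Y = (of_nat (2 * a + 2 * b + 1 choose (2 * a + 1)) :: rat)"
    and "c = (of_nat (2 * a + 2 * b choose (2 * a)) :: rat)" and "n = (of_nat (2 * (a + b) + 1) :: rat)"
    and "s = (2 * of_nat a + 1 :: rat)" and "t = (2 * of_nat b + 1 :: rat)"
  have "(2 * a + 2 * b + 1) * (2 * a + 2 * b choose (2 * a)) = (2 * a + 2 * b + 1 choose (2 * a + 1)) * (2 * a + 1)"
    using Suc_times_binomial_eq[of "2 * a + 2 * b" "2 * a"] by (simp only: Suc_eq_plus1)
  from arg_cong[OF this, of "of_nat :: nat \<Rightarrow> rat"] have Y: "n * c = Y * s"
    unfolding of_nat_mult X_def Y_def c_def n_def s_def by simp
  have "(2 * a + 2 * b + 1) * (2 * a + 2 * b choose (2 * b)) = (2 * a + 2 * b + 1 choose (2 * b + 1)) * (2 * b + 1)"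
    using Suc_times_binomial_eq[of "2 * a + 2 * b" "2 * b"] by (simp only: Suc_eq_plus1)
  moreover have "2 * a + 2 * b choose (2 * b) = 2 * a + 2 * b choose (2 * a)"
    using binomial_symmetric[of "2 * a" "2 * a + 2 * b"] by simp
  ultimately have "(2 * a + 2 * b + 1) * (2 * a + 2 * b choose (2 * a)) = (2 * a + 2 * b + 1 choose (2 * b + 1)) * (2 * b + 1)"
    by simp
  from arg_cong[OF this, of "of_nat :: nat \<Rightarrow> rat"] have X: "n * c = X * t"
    unfolding of_nat_mult X_def Y_def c_def n_def t_def by simp
  have nz: "n \<noteq> 0" "s \<noteq> 0" "t \<noteq> 0"
    unfolding n_def s_def t_def by (simp_all add: add_eq_0_iff_both_eq_0)
  have "X = n * c / t" "Y = n * c / s" using X Y nz by (simp_all add: field_simps)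
  then have "(X - Y) / n = (s - t) / (s * t) * c" using nz by (simp add: field_simps)
  also have "s - t = 2 * (of_nat a - of_nat b)" by (simp add: s_def t_def)
  finally show ?thesis unfolding X_def Y_def c_def n_def s_def t_def .
qed

section \<open>Evaluation of the mixed sum modulo p\<close>
context odd_prime
begin

lemma not_dvd_2: "\<not> p dvd 2"
  using p_eq half_pos by (intro not_dvd_less) auto

text \<open>
  In the recursion only the prime 2 has to be inverted.
\<close>
lemma integral_tanh_number: "integral (tanh_number r)"
proof (induction r rule: less_induct)
  case (less r)
  show ?case
  proof (cases "r = 0")
    case True
    then show ?thesis by (simp add: tanh_number_even)
  next
    case False
    then have "tanh_number r = (1 - (\<Sum>i<r. of_nat (r choose i) * tanh_number i)) / of_nat 2"
      using tanh_number_recursion[of r] by simp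
    also have "integral \<dots>"
      by (intro integral_divide_of_nat integral_diff integral_1 integral_sum integral_mult integral_of_nat not_dvd_2 less) auto
    finally show ?thesis .
  qed
qed

lemma integral_bernoulli: "n + 1 < p \<Longrightarrow> integral (bernoulli n)"
proof (induction n rule: less_induct)
  case (less n)
  have "bernoulli n = ((if n = 0 then 1 else 0) - (\<Sum>i<n. of_nat (Suc n choose i) * bernoulli i)) / of_nat (Suc n)"
    unfolding bernoulli_recursion[symmetric] by (simp del: of_nat_Suc)
  also have "integral \<dots>"
    using less by (intro integral_divide_of_nat integral_diff integral_sum integral_mult integral_of_nat not_dvd_less) auto
  finally show ?case .
qed

text \<open>
  Modulo p the upper index p - 1 - k may be replaced by -1 - k, whose binomial coefficients are those of
  k + l up to sign.
\<close>
lemma choose_reflect: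
  "k + l < p \<Longrightarrow> of_nat ((p - 1 - k) choose l) \<approx> (- 1) ^ l * of_nat ((k + l) choose l)"
proof (induction l)
  case (Suc l)
  have l: "l \<le> p - 1 - k" using Suc.prems by simp
  have "of_nat (Suc l) * of_nat ((p - 1 - k) choose Suc l)
      = (of_nat (p - 1 - k - l) * of_nat ((p - 1 - k) choose l) :: rat)"
    using binomial_absorb_comp[of "p - 1 - k" l] binomial_absorption[of l "p - 1 - k"]
    unfolding of_nat_mult[symmetric] of_nat_eq_iff by (simp add: Suc_times_binomial_eq binomial_absorption) 
  also have "p - 1 - k - l = p - (k + l + 1)" by simp
  also have "of_nat (p - (k + l + 1)) * of_nat ((p - 1 - k) choose l)
      \<approx> - of_nat (k + l + 1) * ((- 1) ^ l * of_nat ((k + l) choose l))"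
    using Suc by (intro cong_p_mult of_nat_reflect) (auto intro: integral_uminus)
  also have "- of_nat (k + l + 1) * ((- 1) ^ l * of_nat ((k + l) choose l))
      = (of_nat (Suc l) * ((- 1) ^ Suc l * of_nat ((k + Suc l) choose Suc l)) :: rat)"
  proof -
    have "of_nat (Suc (k + l)) * of_nat ((k + l) choose l) = (of_nat (Suc l) * of_nat (Suc (k + l) choose Suc l) :: rat)"
      unfolding of_nat_mult[symmetric] of_nat_eq_iff using Suc_times_binomial_eq[of "k + l" l] by (simp only: mult.commute)
    then show ?thesis by (simp add: mult_ac del: of_nat_Suc binomial_Suc_Suc)
  qed
  finally show ?case
    by (rule cong_p_cancel) (use Suc.prems in \<open>intro not_dvd_less, auto\<close>)
qed simp

lemma inverse_square_power_cong:
  assumes "0 < j" "j < p" "b \<le> half"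
  shows "(1 / of_nat j ^ 2) ^ b \<approx> of_nat j ^ (2 * (half - b))"
proof -
  have "2 * (half - b) + 2 * b = p - 1" using assms p_eq by simp
  then have "of_nat j ^ (p - 1) = (of_nat j ^ (2 * (half - b)) * (of_nat j ^ 2) ^ b :: rat)"
    by (simp only: power_add[symmetric] power_mult[symmetric])
  then have "(1 / of_nat j ^ 2) ^ b * of_nat j ^ (p - 1) = (of_nat j ^ (2 * (half - b)) :: rat)"
    using assms by (simp add: power_one_over)
  moreover have "(1 / of_nat j ^ 2) ^ b * of_nat j ^ (p - 1) \<approx> (1 / of_nat j ^ 2) ^ b * 1"
    using assms by (intro cong_p_mult_left fermat_rat integral_power integral_inverse_square)
  ultimately show ?thesis using cong_p_sym by simp
qed

text \<open>
  The denominators involve factorials of at most 2 half = p - 1.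
\<close>
lemma integral_kernel_poly: "integral (coeff (kernel_poly half j) i)" if "0 < j"
  unfolding kernel_poly_def coeff_sum coeff_smult coeff_elementary_poly
proof (intro integral_sum integral_mult)
  fix k assume k: "k \<in> {j..half}"
  have "fact k ^ 2 / (of_nat k * fact (k - j) * fact (k + j)) = (of_nat (fact k ^ 2) / of_nat (k * fact (k - j) * fact (k + j)) :: rat)"
    by simp
  also have "integral \<dots>"
    using k that p_eq prime by (intro integral_divide_of_nat integral_of_nat) (auto simp: prime_dvd_mult_iff not_dvd_fact not_dvd_less)
  finally show "integral (fact k ^ 2 / (of_nat k * fact (k - j) * fact (k + j)))" .
  show "integral (elementary_gf 0 (k - 1) $ i)" using k that p_eq by (intro integral_nth) auto
qed

lemma coeff_kernel_poly_eq_0: "coeff (kernel_poly half j) i = 0" if "half \<le> i" "0 < j"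
  unfolding kernel_poly_def coeff_sum coeff_smult
proof (intro sum.neutral ballI)
  fix k assume "k \<in> {j..half}"
  then have "degree (elementary_poly 0 (k - 1)) < i"
    using degree_elementary_poly[of 0 "k - 1"] that by auto
  then show "fact k ^ 2 / (of_nat k * fact (k - j) * fact (k + j)) * coeff (elementary_poly 0 (k - 1)) i = 0"
    by (simp add: coeff_eq_0)
qed

lemma coeff_kernel_poly_cong:
  assumes "0 < j" "a < half"
  shows "coeff (kernel_poly half j) a \<approx>
    2 * (\<Sum>m\<in>{1..half}. (- 1) ^ m * (if j < m then 1 else if j = m then 1 / 2 else 0) * of_nat m ^ (2 * (half - a) - 1))"
proof -
  have "coeff (kernel_poly half j) a \<approx>
     - 2 * (\<Sum>m\<in>{1..half}. poly (kernel_poly half j) (of_nat m ^ 2) * of_nat m ^ (2 * (half - a)))"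
    using assms by (intro coefficient_extraction integral_kernel_poly coeff_kernel_poly_eq_0)
  also have "(\<Sum>m\<in>{1..half}. poly (kernel_poly half j) (of_nat m ^ 2) * of_nat m ^ (2 * (half - a)))
     = (\<Sum>m\<in>{1..half}. - ((- 1) ^ m * (if j < m then 1 else if j = m then 1 / 2 else 0) * of_nat m ^ (2 * (half - a) - 1)))"
  proof (rule sum.cong)
    fix m assume m: "m \<in> {1..half}"
    have "2 * (half - a) = Suc (2 * (half - a) - 1)" using assms by simp
    then have "of_nat m ^ (2 * (half - a)) = (of_nat m * of_nat m ^ (2 * (half - a) - 1) :: rat)"
      by (metis power_Suc)
    then show "poly (kernel_poly half j) (of_nat m ^ 2) * of_nat m ^ (2 * (half - a))
       = - ((- 1) ^ m * (if j < m then 1 else if j = m then 1 / 2 else 0) * of_nat m ^ (2 * (half - a) - 1))"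
      using m assms by (subst poly_kernel_poly) auto
  qed simp
  finally show ?thesis by (simp add: sum_negf)
qed

text \<open>
  Recovering the coefficients of the kernel polynomials from their values leaves a double sum over
  j \<le> m.  Twice its inner sum over j is m q(m^2) with q a polynomial of degree less than half, so the sum over m
  is again of the form in which it recovers a coefficient, this time that of q.
\<close>
lemma mixed_sum_half_cong:
  assumes ab: "a + b < half"
  shows "mixed_sum half a b \<approx> of_nat (2 * (half - b) choose (2 * a + 1)) * tanh_number (2 * (half - b) - (2 * a + 1))"
proof -
  define B where "B = half - b"
  define u where "u = 2 * (half - a) - 1"
  define \<theta> :: "nat \<Rightarrow> nat \<Rightarrow> rat" where "\<theta> j m = (if j < m then 1 else if j = m then 1 / 2 else 0)" for j m
  define q where "q = (\<Sum>c<B. monom (of_nat (2 * B choose (2 * c + 1)) * tanh_number (2 * B - (2 * c + 1))) c)"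
  have B: "0 < B" "B \<le> half" "a < B" using ab by (auto simp: B_def)
  have coeff_q: "coeff q i = (if i < B then of_nat (2 * B choose (2 * i + 1)) * tanh_number (2 * B - (2 * i + 1)) else 0)" for i
    unfolding q_def by (simp add: coeff_sum)
  have inner: "2 * (\<Sum>j\<in>{1..half}. \<theta> j m * (- 1) ^ (j + m) * of_nat j ^ (2 * B)) = of_nat m * poly q (of_nat m ^ 2)"
    if m: "m \<in> {1..half}" for m
  proof -
    have "(\<Sum>j\<in>{1..half}. \<theta> j m * (- 1) ^ (j + m) * of_nat j ^ (2 * B)) = (\<Sum>j\<le>m. \<theta> j m * (- 1) ^ (j + m) * of_nat j ^ (2 * B))"
      using m B by (intro sum.mono_neutral_cong) (auto simp: \<theta>_def)
    also have "\<dots> = (\<Sum>j<m. (- 1) ^ (j + m) * of_nat j ^ (2 * B)) + of_nat m ^ (2 * B) / 2"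
      unfolding lessThan_Suc_atMost[symmetric] by (simp add: \<theta>_def flip: mult_2)
    finally have "2 * (\<Sum>j\<in>{1..half}. \<theta> j m * (- 1) ^ (j + m) * of_nat j ^ (2 * B))
       = (\<Sum>i\<le>2 * B. of_nat (2 * B choose i) * tanh_number (2 * B - i) * of_nat m ^ i)"
      using alternating_power_sum[of "2 * B" m] B by simp
    also have "\<dots> = (\<Sum>c<B. of_nat (2 * B choose (2 * c + 1)) * tanh_number (2 * B - (2 * c + 1)) * of_nat m ^ (2 * c + 1))"
      by (rule sum_odd_indices) (auto intro!: tanh_number_even)
    also have "\<dots> = of_nat m * poly q (of_nat m ^ 2)"
      unfolding q_def poly_sum poly_monom sum_distrib_left
      by (intro sum.cong) (simp_all add: power_add mult_ac flip: power_mult)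
    finally show ?thesis .
  qed
  have "mixed_sum half a b \<approx> (\<Sum>j\<in>{1..half}. 2 * (- 1) ^ (j + 1) * (of_nat j ^ (2 * B)
     * (2 * (\<Sum>m\<in>{1..half}. (- 1) ^ m * \<theta> j m * of_nat m ^ u))))"
    unfolding mixed_sum_kernel_poly mult.assoc[of _ "(1 / _ ^ 2) ^ b"]
  proof (intro cong_p_sum cong_p_mult_left cong_p_mult)
    fix j assume j: "j \<in> {1..half}"
    then show "(1 / of_nat j ^ 2) ^ b \<approx> of_nat j ^ (2 * B)"
      unfolding B_def using ab p_eq by (intro inverse_square_power_cong) auto
    show "coeff (kernel_poly half j) a \<approx> 2 * (\<Sum>m\<in>{1..half}. (- 1) ^ m * \<theta> j m * of_nat m ^ u)"
      unfolding \<theta>_def u_def using j ab by (intro coeff_kernel_poly_cong) auto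
    show "integral (coeff (kernel_poly half j) a)" using j by (intro integral_kernel_poly) auto
  qed (auto intro!: integral_mult integral_power integral_uminus)
  also have "\<dots> = (\<Sum>j\<in>{1..half}. \<Sum>m\<in>{1..half}. - 2 * (of_nat m ^ u * (2 * (\<theta> j m * (- 1) ^ (j + m) * of_nat j ^ (2 * B)))))"
    by (simp add: sum_distrib_left power_add mult_ac sum_negf)
  also have "\<dots> = (\<Sum>m\<in>{1..half}. \<Sum>j\<in>{1..half}. - 2 * (of_nat m ^ u * (2 * (\<theta> j m * (- 1) ^ (j + m) * of_nat j ^ (2 * B)))))"
    by (rule sum.swap)
  also have "\<dots> = - 2 * (\<Sum>m\<in>{1..half}. of_nat m ^ u * (2 * (\<Sum>j\<in>{1..half}. \<theta> j m * (- 1) ^ (j + m) * of_nat j ^ (2 * B))))"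
    unfolding sum_distrib_left ..
  also have "\<dots> = - 2 * (\<Sum>m\<in>{1..half}. poly q (of_nat m ^ 2) * of_nat m ^ (2 * (half - a)))"
  proof -
    have "2 * (half - a) = Suc u" using ab by (simp add: u_def)
    then show ?thesis using inner by (simp add: mult_ac)
  qed
  also have "\<dots> \<approx> coeff q a"
  proof (rule cong_p_sym, rule coefficient_extraction)
    show "coeff q i = 0" if "i \<ge> half" for i using that B by (simp add: coeff_q)
    show "integral (coeff q i)" for i by (simp add: coeff_q integral_tanh_number)
  qed (use ab in simp)
  finally show ?thesis using B unfolding coeff_q by (simp add: B_def)
qed

lemma mixed_sum_full_cong:
  assumes "a + b < half"
  shows "mixed_sum (p - 1) a b \<approx> (of_nat (2 * a + 2 * b + 1 choose (2 * b + 1)) - of_nat (2 * a + 2 * b + 1 choose (2 * a + 1)))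
      * tanh_number (2 * half - (2 * a + 2 * b + 1))"
proof -
  have half: "mixed_sum half a b \<approx> - of_nat (2 * a + 2 * b + 1 choose (2 * a + 1)) * tanh_number (2 * half - (2 * a + 2 * b + 1))"
    if "a + b < half" for a b
  proof -
    have e: "2 * (half - b) = p - 1 - 2 * b" "2 * (half - b) - (2 * a + 1) = 2 * half - (2 * a + 2 * b + 1)"
      using p_eq by auto
    have "mixed_sum half a b \<approx> of_nat (p - 1 - 2 * b choose (2 * a + 1)) * tanh_number (2 * half - (2 * a + 2 * b + 1))"
      using mixed_sum_half_cong[OF that] unfolding e(2) unfolding e(1) .
    also have "\<dots> \<approx> ((- 1) ^ (2 * a + 1) * of_nat (2 * b + (2 * a + 1) choose (2 * a + 1))) * tanh_number (2 * half - (2 * a + 2 * b + 1))"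
      using that p_eq by (intro cong_p_mult choose_reflect cong_p_refl integral_tanh_number integral_mult integral_power integral_uminus) auto
    also have "2 * b + (2 * a + 1) = 2 * a + 2 * b + 1" by simp
    finally show ?thesis by simp
  qed
  have "mixed_sum (p - 1) a b \<approx> mixed_sum half a b - mixed_sum half b a"
    using assms by (intro mixed_sum_reflect) auto
  also have "\<dots> \<approx> - of_nat (2 * a + 2 * b + 1 choose (2 * a + 1)) * tanh_number (2 * half - (2 * a + 2 * b + 1))
     - - of_nat (2 * b + 2 * a + 1 choose (2 * b + 1)) * tanh_number (2 * half - (2 * b + 2 * a + 1))"
    using assms by (intro cong_p_diff half) auto
  also have "2 * b + 2 * a + 1 = 2 * a + 2 * b + 1" by simp
  also have "- x * t - - y * t = (y - x) * t" for x y t :: rat by (simp add: algebra_simps)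
  finally show ?thesis .
qed

text \<open>
  With M = p - 1 - 2N, Fermat gives 2^M = 4^(-N) modulo p, and M is congruent to -(2N + 1).
\<close>
lemma tanh_number_cong:
  assumes "0 < N" "N < half"
  shows "tanh_number (2 * half - (2 * N + 1)) \<approx> 2 * (1 - 1 / 4 ^ N) * bernoulli (p - 2 * N - 1) / of_nat (2 * N + 1)"
proof -
  define M where "M = p - (2 * N + 1)"
  have M: "Suc (2 * half - (2 * N + 1)) = M" "p - 2 * N - 1 = M" "0 < 2 * half - (2 * N + 1)" "M + 2 * N = p - 1" "M + 1 < p"
    using assms p_eq by (auto simp: M_def)
  have N: "2 * N + 1 < p" using assms p_eq by simp
  have two: "(2 :: rat) ^ M \<approx> 1 / 4 ^ N"
  proof (rule cong_p_cancel[of "4 ^ N"])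
    have "of_nat (4 ^ N) * 2 ^ M = (2 ^ (p - 1) :: rat)"
      unfolding M(4)[symmetric] by (simp add: power_add power_mult)
    also have "\<dots> \<approx> 1" using fermat_rat[of 2] p_eq half_pos by simp
    finally show "of_nat (4 ^ N) * 2 ^ M \<approx> of_nat (4 ^ N) * (1 / 4 ^ N)" by simp
    have "(4 :: nat) = 2 ^ 2" by simp
    then show "\<not> p dvd 4 ^ N" using prime not_dvd_2 by (metis prime_dvd_power)
  qed
  have int: "integral (1 / 4 ^ N)" "integral (bernoulli M)" "integral (1 / of_nat (2 * N + 1))"
  proof -
    show "integral (1 / 4 ^ N)" by (rule cong_p_integral[OF cong_p_sym[OF two]]) (intro integral_power integral_numeral)
    show "integral (bernoulli M)" by (rule integral_bernoulli) (rule M)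
    show "integral (1 / of_nat (2 * N + 1))" using N not_dvd_less by (intro integral_inverse_of_nat) auto
  qed
  have "1 / of_nat (p - (2 * N + 1)) \<approx> - (1 / of_nat (2 * N + 1))"
    using N by (intro inverse_reflect) auto
  then have M': "1 / of_nat M \<approx> - (1 / of_nat (2 * N + 1))" unfolding M_def .
  have "2 * (2 ^ M - 1) * bernoulli M * (1 / of_nat M) \<approx> 2 * (1 / 4 ^ N - 1) * bernoulli M * - (1 / of_nat (2 * N + 1))"
  proof (intro cong_p_mult M' cong_p_diff two cong_p_refl)
    show "integral (1 / of_nat M)" using M(3,5) unfolding M(1)[symmetric]
      by (intro integral_inverse_of_nat not_dvd_less) auto
  qed (intro integral_mult integral_diff integral_1 integral_numeral integral_power int)+
  also have "2 * (w - 1) * B * - (1 / n) = 2 * (1 - w) * B / n" for w B n :: rat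
    by (simp add: algebra_simps diff_divide_distrib)
  finally show ?thesis unfolding M(2) tanh_number_bernoulli[OF M(3)] M(1) by simp
qed

text \<open>
  The case a = b = 0 is separate because the Bernoulli number of index p - 1 is not p-integral; there both
  sides vanish, the left one by antisymmetry.
\<close>
lemma mixed_sum_full_closed_form:
  assumes "a + b < half"
  shows "mixed_sum (p - 1) a b \<approx> 4 * (of_nat a - of_nat b) * (1 - 4 powi (- int a - int b))
              / ((2 * of_nat a + 1) * (2 * of_nat b + 1))
              * of_nat ((2 * a + 2 * b) choose (2 * a))
              * bernoulli (p - 2 * a - 2 * b - 1)"
proof (cases "a + b = 0")
  case True
  then show ?thesis using mixed_sum_reflect[of 0 0] half_pos by simp
next
  case False
  let ?D = "of_nat (2 * a + 2 * b + 1 choose (2 * b + 1)) - of_nat (2 * a + 2 * b + 1 choose (2 * a + 1)) :: rat"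
  have N: "2 * (a + b) = 2 * a + 2 * b" "p - 2 * (a + b) - 1 = p - 2 * a - 2 * b - 1" by simp_all
  have powi: "(4 :: rat) powi (- int a - int b) = 1 / 4 ^ (a + b)"
  proof -
    have "- int a - int b = - int (a + b)" by simp
    then show ?thesis by (simp only: power_int_minus power_int_of_nat) (simp add: divide_inverse)
  qed
  have "mixed_sum (p - 1) a b \<approx> ?D * tanh_number (2 * half - (2 * (a + b) + 1))"
    using mixed_sum_full_cong[OF assms] by simp
  also have "\<dots> \<approx> ?D * (2 * (1 - 1 / 4 ^ (a + b)) * bernoulli (p - 2 * (a + b) - 1) / of_nat (2 * (a + b) + 1))"
    using False assms by (intro cong_p_mult_left tanh_number_cong) auto
  also have "\<dots> = (?D / of_nat (2 * (a + b) + 1)) * (2 * (1 - 1 / 4 ^ (a + b)) * bernoulli (p - 2 * a - 2 * b - 1))"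
    unfolding N(2) by simp
  also have "\<dots> = 4 * (of_nat a - of_nat b) * (1 - 4 powi (- int a - int b))
              / ((2 * of_nat a + 1) * (2 * of_nat b + 1))
              * of_nat ((2 * a + 2 * b) choose (2 * a))
              * bernoulli (p - 2 * a - 2 * b - 1)"
  proof -
    have "2 * d / n * c * (2 * w * B) = 4 * d * w / n * c * B" for d n c w B :: rat by simp
    then show ?thesis unfolding choose_odd_difference powi .
  qed
  finally show ?thesis .
qed

end

theorem theorem4p2:
  fixes a b p :: nat
  assumes "prime p"
    and "p > 2 * a + 2 * b + 1"
    and "p \<noteq> 2"
  shows "rat_cong
           (multiple_harmonic_star_sum (replicate a 2 @ [1] @ replicate b 2) (p - 1))
           (4 * (of_nat b - of_nat a) * (1 - 4 powi (- int a - int b))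
              / ((2 * of_nat a + 1) * (2 * of_nat b + 1))
              * of_nat ((2 * a + 2 * b) choose (2 * a))
              * bernoulli (p - 2 * a - 2 * b - 1))
           p
         \<and> rat_cong
           (multiple_harmonic_sum (replicate a 2 @ [1] @ replicate b 2) (p - 1))
           (4 * (- 1) ^ (a + b) * (of_nat a - of_nat b) * (1 - 4 powi (- int a - int b))
              / ((2 * of_nat a + 1) * (2 * of_nat b + 1))
              * of_nat ((2 * a + 2 * b) choose (2 * a))
              * bernoulli (p - 2 * a - 2 * b - 1))
           p"
proof -
  interpret odd_prime p using assms by unfold_locales
  have ab: "a + b < half" using assms(2) p_eq by linarith
  have swap: "- int b - int a = - int a - int b" "p - 2 * b - 2 * a - 1 = p - 2 * a - 2 * b - 1"
    "2 * b + 2 * a choose (2 * b) = 2 * a + 2 * b choose (2 * a)"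
    "(2 * of_nat b + 1) * (2 * of_nat a + 1) = (2 * of_nat a + 1) * (2 * of_nat b + 1 :: rat)"
    using binomial_symmetric[of "2 * a" "2 * a + 2 * b"] by (simp_all add: add.commute)
  have "multiple_harmonic_star_sum (replicate a 2 @ [1] @ replicate b 2) (p - 1) \<approx> mixed_sum (p - 1) b a"
    by (rule multiple_harmonic_star_sum_cong_mixed_sum) (use ab in simp)
  also have "\<dots> \<approx> 4 * (of_nat b - of_nat a) * (1 - 4 powi (- int a - int b))
              / ((2 * of_nat a + 1) * (2 * of_nat b + 1))
              * of_nat ((2 * a + 2 * b) choose (2 * a))
              * bernoulli (p - 2 * a - 2 * b - 1)"
    using mixed_sum_full_closed_form[of b a] ab unfolding swap by simp
  finally have S: "multiple_harmonic_star_sum (replicate a 2 @ [1] @ replicate b 2) (p - 1)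
      \<approx> 4 * (of_nat b - of_nat a) * (1 - 4 powi (- int a - int b))
              / ((2 * of_nat a + 1) * (2 * of_nat b + 1))
              * of_nat ((2 * a + 2 * b) choose (2 * a))
              * bernoulli (p - 2 * a - 2 * b - 1)" .
  have "multiple_harmonic_sum (replicate a 2 @ [1] @ replicate b 2) (p - 1) \<approx> (- 1) ^ (a + b) * mixed_sum (p - 1) a b"
    by (rule multiple_harmonic_sum_cong_mixed_sum) (use ab in simp)
  also have "\<dots> \<approx> (- 1) ^ (a + b) * (4 * (of_nat a - of_nat b) * (1 - 4 powi (- int a - int b))
              / ((2 * of_nat a + 1) * (2 * of_nat b + 1))
              * of_nat ((2 * a + 2 * b) choose (2 * a))
              * bernoulli (p - 2 * a - 2 * b - 1))"
    by (intro cong_p_mult_left mixed_sum_full_closed_form ab integral_power integral_uminus integral_1)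
  also have "\<dots> = 4 * (- 1) ^ (a + b) * (of_nat a - of_nat b) * (1 - 4 powi (- int a - int b))
              / ((2 * of_nat a + 1) * (2 * of_nat b + 1))
              * of_nat ((2 * a + 2 * b) choose (2 * a))
              * bernoulli (p - 2 * a - 2 * b - 1)"
    by (simp add: mult_ac)
  finally show ?thesis using S by (blast intro: rat_cong_if_cong_p)
qed

end
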